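(* Let $\mathbb{M}$ be either the Euclidean plane $\mathbb{R}^2$ or the unit sphere $\mathbb{S}^2$, let $n\geq 3$ and $k\geq 1$ be integers, and let $P_1,\dots,P_k$ and $P$ be regular $n$-gons in $\mathbb{M}$ with areas $a_1,\dots,a_k$ and $a$ respectively, satisfying $\sum_{i=1}^k a_i=a$. Then $$\mathrm{perim}(P)\leq\sum_{i=1}^k\mathrm{perim}(P_i).$$
   Context: $\mathbb{R}^2$ carries the flat metric (curvature $0$) and $\mathbb{S}^2$ the round metric of constant curvature $1$. Polygons are geodesic polygons and are non-degenerate (non-zero area); $\mathrm{perim}$ denotes the perimeter, i.e. the sum of the side lengths. A regular $n$-gon has all sides equal and all interior angles equal. A regular spherical $n$-gon with interior angle $\theta$ has area $n\theta-(n-2)\pi$, and its interior angle satisfies $\frac{(n-2)\pi}{n}<\theta<\pi$. *)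

theory Defs
  imports "HOL-Analysis.Analysis"
begin

record 'a geometry =
  pts :: "'a set"
  gdist :: "'a \<Rightarrow> 'a \<Rightarrow> real"
  gseg :: "'a \<Rightarrow> 'a \<Rightarrow> 'a set"
  orient :: "'a \<Rightarrow> 'a \<Rightarrow> 'a \<Rightarrow> real"
  tdot :: "'a \<Rightarrow> 'a \<Rightarrow> 'a \<Rightarrow> real"
  garea :: "'a set \<Rightarrow> real"

text \<open>
  \<open>tdot p a b\<close> is the inner product of the tangent vectors at \<open>p\<close> pointing to \<open>a\<close> and \<open>b\<close>,
  and \<open>orient p a b\<close> is the signed area they span.  Moreover \<open>orient p q x > 0\<close> says that \<open>x\<close>
  lies strictly to the left of the oriented geodesic from \<open>p\<close> to \<open>q\<close>.
\<close>

definition euclidean_plane :: "(real^2) geometry" where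
  "euclidean_plane =
    \<lparr> pts = UNIV,
      gdist = dist,
      gseg = closed_segment,
      orient = (\<lambda>p a b. (a - p)$1 * (b - p)$2 - (a - p)$2 * (b - p)$1),
      tdot = (\<lambda>p a b. (a - p) \<bullet> (b - p)),
      garea = measure lebesgue \<rparr>"

text \<open>
  The minimal geodesic between non-antipodal points of the unit sphere is the radial projection
  of their chord.  (For antipodal points this set contains \<open>sgn 0 = 0\<close>, so it is not a subset of
  the sphere; see \<open>geodesic_polygon\<close>.)  The tangent vector at \<open>p\<close> towards \<open>a\<close> is taken to be
  \<open>a - (p \<bullet> a) p\<close>, of length \<open>sin (gdist p a)\<close>.  The surface area of a subset of the unit
  sphere is three times the volume of the cone over it with apex at the origin.
\<close>

definition unit_sphere :: "(real^3) geometry" where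
  "unit_sphere =
    \<lparr> pts = sphere 0 1,
      gdist = (\<lambda>p q. arccos (p \<bullet> q)),
      gseg = (\<lambda>p q. sgn ` closed_segment p q),
      orient = (\<lambda>p a b. p \<bullet> cross3 a b),
      tdot = (\<lambda>p a b. (a - (p \<bullet> a) *\<^sub>R p) \<bullet> (b - (p \<bullet> b) *\<^sub>R p)),
      garea = (\<lambda>A. 3 * measure lebesgue {t *\<^sub>R x |t x. 0 \<le> t \<and> t \<le> 1 \<and> x \<in> A}) \<rparr>"

record 'a polygon =
  verts :: "'a list"
  region :: "'a set"

definition vert :: "'a polygon \<Rightarrow> nat \<Rightarrow> 'a" where
  "vert Q i = verts Q ! (i mod length (verts Q))"

definition side :: "'a geometry \<Rightarrow> 'a polygon \<Rightarrow> nat \<Rightarrow> 'a set" where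
  "side M Q i = gseg M (vert Q i) (vert Q (i + 1))"

definition side_length :: "'a geometry \<Rightarrow> 'a polygon \<Rightarrow> nat \<Rightarrow> real" where
  "side_length M Q i = gdist M (vert Q i) (vert Q (i + 1))"

definition perim :: "'a geometry \<Rightarrow> 'a polygon \<Rightarrow> real" where
  "perim M Q = (\<Sum>i<length (verts Q). side_length M Q i)"

definition area :: "'a geometry \<Rightarrow> 'a polygon \<Rightarrow> real" where
  "area M Q = garea M (region Q)"

text \<open>
  A polygon is a compact region bounded by a simple closed chain of geodesic segments, its
  vertices being listed so that the region lies to the left of every side.  The orientation is
  only a labelling convention in the plane; on the sphere it also tells which of the two regions
  bounded by the chain is meant.
\<close>

definition geodesic_polygon :: "'a::metric_space geometry \<Rightarrow> 'a polygon \<Rightarrow> bool" where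
  "geodesic_polygon M Q \<longleftrightarrow>
    (let n = length (verts Q) in
      3 \<le> n \<and> distinct (verts Q) \<and> set (verts Q) \<subseteq> pts M \<and>
      (\<forall>i<n. side M Q i \<subseteq> pts M) \<and>
      (\<forall>i<n. \<forall>j<n. i \<noteq> j \<longrightarrow>
         side M Q i \<inter> side M Q j = {vert Q i, vert Q (i + 1)} \<inter> {vert Q j, vert Q (j + 1)}) \<and>
      region Q \<subseteq> pts M \<and> compact (region Q) \<and>
      top_of_set (pts M) frontier_of region Q = (\<Union>i<n. side M Q i) \<and>
      (\<forall>i<n. \<forall>x \<in> side M Q i - {vert Q i, vert Q (i + 1)}. \<exists>e>0.
         {y \<in> pts M. dist x y < e \<and> orient M (vert Q i) (vert Q (i + 1)) y > 0} \<subseteq> region Q) \<and>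
      area M Q \<noteq> 0)"

text \<open>
  Since the region lies to the left, the interior angle at a vertex is swept by turning
  counterclockwise from the outgoing side to the incoming one; it may be reflex.
\<close>

definition interior_angle :: "'a geometry \<Rightarrow> 'a polygon \<Rightarrow> nat \<Rightarrow> real" where
  "interior_angle M Q i =
    (let p = vert Q i; a = vert Q (i + 1); b = vert Q (i + length (verts Q) - 1)
     in Arg2pi (Complex (tdot M p a b) (orient M p a b)))"

text \<open>
  The bound \<open>\<theta> < pi\<close> holds automatically in the plane.  On the sphere it rules out the hemisphere,
  whose sides all lie on one great circle, and the complement of a convex regular polygon.
\<close>

definition regular_ngon :: "'a::metric_space geometry \<Rightarrow> nat \<Rightarrow> 'a polygon \<Rightarrow> bool" where
  "regular_ngon M n Q \<longleftrightarrow>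
    geodesic_polygon M Q \<and> length (verts Q) = n \<and>
    (\<exists>s. \<forall>i<n. side_length M Q i = s) \<and>
    (\<exists>\<theta><pi. \<forall>i<n. interior_angle M Q i = \<theta>)"

end

theory Submission
  imports Defs
begin

text \<open>
  A regular \<open>n\<close>-gon has its vertices on a circle, and simplicity of the boundary forces consecutive
  vertices to be \<open>2 * pi / n\<close> apart as seen from the centre, since the sides of a star polygon cross.
  The region is then cut out by the half-planes (half-spaces through the origin, on the sphere) of its sides.

  In the plane the area is therefore a constant times the square of the perimeter, and the
  inequality is the comparison of the Euclidean norm with the sum norm.

  On the sphere the polygon splits into \<open>n\<close> triangles around the centre, and Girard's theorem,
  obtained by inclusion-exclusion from the volume of lunes, gives half the side length as
  \<open>f x = arccos (cos a / cos (a - x))\<close> with \<open>a = pi / n\<close> and \<open>x = area / (2 * n)\<close>. The derivative of \<open>f\<close>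
  decreases and \<open>f 0 = 0\<close>, so \<open>f x / x\<close> decreases, which makes \<open>f\<close> subadditive.
\<close>

section \<open>One-variable estimates and star polygons\<close>

text \<open>The formula for \<open>f\<close> comes from the right triangle formed by the centre, the
  midpoint of a side and a vertex. It is one of \<open>2 * n\<close> congruent pieces, so its area
  is \<open>x\<close>. Its angle at the centre is \<open>a\<close>; with \<open>B\<close> for half
  the interior angle, \<open>x = a + B - pi / 2\<close>, and
  \<open>cos a = cos (half side) * sin B\<close> becomes
  \<open>cos a = cos (half side) * cos (a - x)\<close>.

  Two things are not given and have to be recovered. A regular polygon is known only by equal
  lengths and angles; its circle is found because consecutive vertices satisfy a linear recurrence
  with constant coefficients. Its region is known only as a compact set with a prescribed frontier.
  A connected set that misses the frontier lies inside or outside the region; the plane decides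
  between the two by compactness and nonzero area, the sphere by the condition that the region lies
  to the left of a side.

  Spherical area is defined through the volume of a cone, so Girard's theorem concerns pieces of the
  ball cut out by half-spaces; its only analytic input is that the volume of a wedge is proportional
  to its angle.\<close>

lemma additive_on_interval_linear:
  fixes g :: "real \<Rightarrow> real"
  assumes c: "0 < c"
    and add: "\<And>x y. 0 \<le> x \<Longrightarrow> 0 \<le> y \<Longrightarrow> x + y \<le> c \<Longrightarrow> g (x + y) = g x + g y"
    and nonneg: "\<And>x. 0 \<le> x \<Longrightarrow> x \<le> c \<Longrightarrow> 0 \<le> g x"
    and x: "0 \<le> x" "x \<le> c"
  shows "g x = x / c * g c"
proof (rule ccontr)
  assume ne: "g x \<noteq> x / c * g c"
  \<comment> \<open>The deviation from linearity is additive and vanishes at \<open>c\<close>, like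
    an additive function on a circle of length \<open>c\<close>. Nonnegativity of \<open>g\<close>
    bounds it by \<open>g c\<close>, whereas a nonzero value would have arbitrarily large multiples
    among the values of \<open>h\<close>.\<close>
  define h where "h t = g t - t / c * g c" for t
  have hadd: "h (s + t) = h s + h t" if "0 \<le> s" "0 \<le> t" "s + t \<le> c" for s t
    using add[OF that] by (simp add: h_def add_divide_distrib algebra_simps)
  have hc: "h c = 0" using c by (simp add: h_def)
  have bound: "\<bar>h t\<bar> \<le> g c" if t: "0 \<le> t" "t \<le> c" for t
  proof -
    have "g c = g t + g (c - t)" using add[of t "c - t"] t by simp
    moreover have "0 \<le> g (c - t)" "0 \<le> g t" using nonneg t by simp_all
    moreover have "0 \<le> t / c * g c" using t c nonneg[of c] by simp
    moreover have "t / c * g c \<le> 1 * g c"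
      using t c nonneg[of c] by (intro mult_right_mono) auto
    ultimately show ?thesis by (simp add: h_def abs_le_iff)
  qed
  \<comment> \<open>The witness is \<open>N * x\<close> reduced modulo \<open>c\<close>: once
    \<open>y + x\<close> exceeds \<open>c\<close>, the overflow \<open>x - (c - y)\<close> replaces
    it, at the cost of \<open>h c = 0\<close>.\<close>
  have orbit: "\<exists>y. 0 \<le> y \<and> y \<le> c \<and> h y = real N * h x" for N
  proof (induction N)
    case 0
    have "h 0 = 0" using hadd[of 0 0] c by simp
    then show ?case using c by (intro exI[of _ 0]) auto
  next
    case (Suc N)
    then obtain y where y: "0 \<le> y" "y \<le> c" "h y = real N * h x" by blast
    show ?case
    proof (cases "y + x \<le> c")
      case True
      then show ?thesis using hadd[of y x] y x
        by (intro exI[of _ "y + x"]) (auto simp: algebra_simps)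
    next
      case False
      have "h x = h (c - y) + h (x - (c - y))" using hadd[of "c - y" "x - (c - y)"] False x y by simp
      moreover have "h c = h y + h (c - y)" using hadd[of y "c - y"] y by simp
      ultimately have "h (x - (c - y)) = real (Suc N) * h x" using hc y by (simp add: algebra_simps)
      then show ?thesis using False x y by (intro exI[of _ "x - (c - y)"]) auto
    qed
  qed
  have "h x \<noteq> 0" using ne by (simp add: h_def)
  then obtain N where N: "real N * \<bar>h x\<bar> > g c"
    by (metis reals_Archimedean3 zero_less_abs_iff)
  obtain y where "0 \<le> y" "y \<le> c" "h y = real N * h x" using orbit by blast
  with bound[of y] N show False by (simp add: abs_mult)
qed

text \<open>By the mean value theorem the quotient of increments is larger on \<open>[0, x]\<close> than on \<open>[x, X]\<close>.\<close>

lemma decreasing_derivative_star_shaped: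
  fixes f f' :: "real \<Rightarrow> real"
  assumes cont: "continuous_on {0..X} f" and f0: "f 0 = 0"
    and der: "\<And>t. 0 < t \<Longrightarrow> t < X \<Longrightarrow> (f has_real_derivative f' t) (at t)"
    and dec: "\<And>s t. 0 < s \<Longrightarrow> s \<le> t \<Longrightarrow> t < X \<Longrightarrow> f' t \<le> f' s"
    and x: "0 < x" "x \<le> X"
  shows "x / X * f X \<le> f x"
proof (cases "x = X")
  case True
  then show ?thesis using x by simp
next
  case False
  with x have xX: "x < X" by simp
  have "\<exists>l z. 0 < z \<and> z < x \<and> DERIV f z :> l \<and> f x - f 0 = (x - 0) * l"
    using x xX by (intro MVT) (auto intro: continuous_on_subset[OF cont] der
        simp: real_differentiable_def, meson der less_trans)
  then obtain l z where z: "0 < z" "z < x" "DERIV f z :> l" "f x = x * l" using f0 by auto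
  have "\<exists>l z. x < z \<and> z < X \<and> DERIV f z :> l \<and> f X - f x = (X - x) * l"
    using x xX by (intro MVT) (auto intro: continuous_on_subset[OF cont] der
        simp: real_differentiable_def, meson der less_trans)
  then obtain l' z' where z': "x < z'" "z' < X" "DERIV f z' :> l'" "f X - f x = (X - x) * l'" by auto
  have "l = f' z" using der[of z] z xX DERIV_unique by fastforce
  moreover have "l' = f' z'" using der[of z'] z' x DERIV_unique by fastforce
  ultimately have ll: "l' \<le> l" using dec[of z z'] z z' by simp
  have "f X = x * l + (X - x) * l'" using z z' by simp
  also have "\<dots> \<le> x * l + (X - x) * l" using ll xX by (intro add_left_mono mult_left_mono) auto
  finally have "f X \<le> X * l" by (simp add: algebra_simps)
  then have "x * f X \<le> x * (X * l)" using x by (intro mult_left_mono) auto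
  then show ?thesis using z x xX by (simp add: field_simps)
qed

lemma half_side_star_shaped:
  fixes a x X :: real
  assumes a: "0 < a" "a < pi / 2" and x: "0 < x" "x \<le> X" "X < a"
  shows "x / X * arccos (cos a / cos (a - X)) \<le> arccos (cos a / cos (a - x))"
proof -
  define f where "f t = arccos (cos a / cos (a - t))" for t
  \<comment> \<open>This is unbounded near 0, so only continuity of \<open>f\<close> is used at that
    end. It decreases because \<open>tan (a - t)\<close> decreases while \<open>cos (a - t)\<close>
    increases.\<close>
  define f' where "f' t = cos a * tan (a - t) / sqrt ((cos (a - t))\<^sup>2 - (cos a)\<^sup>2)" for t
  have ca: "0 < cos a" using a by (intro cos_gt_zero_pi) auto
  have ct: "cos a \<le> cos (a - t)" if "0 \<le> t" "t < a" for t
    using that a by (intro cos_monotone_0_pi_le) auto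
  have ct': "cos a < cos (a - t)" if "0 < t" "t < a" for t
    using that a by (intro cos_monotone_0_pi) auto
  have quot: "-1 \<le> cos a / cos (a - t)" "cos a / cos (a - t) \<le> 1" if "0 \<le> t" "t < a" for t
    using ct[OF that] ca by (auto intro: order_trans[of _ 0] simp: divide_le_eq_1)
  have "x / X * f X \<le> f x"
  proof (rule decreasing_derivative_star_shaped[where f' = f'])
    have "continuous_on {0..X} (\<lambda>t. cos a / cos (a - t))"
      using ct ca x by (intro continuous_intros) fastforce
    then show "continuous_on {0..X} f" unfolding f_def
      using quot x by (intro continuous_on_arccos) auto
    show "f 0 = 0" using ca by (simp add: f_def)
  next
    fix t assume t: "0 < t" "t < X"
    have lt: "cos a < cos (a - t)" and pos: "0 < cos (a - t)" using ct'[of t] t x ca by auto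
    have q: "-1 < cos a / cos (a - t)" "cos a / cos (a - t) < 1"
      using lt ca pos by (auto intro: less_trans[of _ 0])
    have d: "((\<lambda>t. cos a / cos (a - t)) has_real_derivative
        - (cos a * sin (a - t)) / (cos (a - t))\<^sup>2) (at t)"
      using pos by (auto intro!: derivative_eq_intros simp: power2_eq_square)
    have "(f has_real_derivative
        inverse (- sqrt (1 - (cos a / cos (a - t))\<^sup>2)) * (- (cos a * sin (a - t)) / (cos (a - t))\<^sup>2)) (at t)"
      unfolding f_def by (rule DERIV_chain2[OF DERIV_arccos[OF q] d])
    moreover have "inverse (- sqrt (1 - (cos a / cos (a - t))\<^sup>2)) * (- (cos a * sin (a - t)) / (cos (a - t))\<^sup>2) = f' t"
    proof -
      have "1 - (cos a / cos (a - t))\<^sup>2 = ((cos (a - t))\<^sup>2 - (cos a)\<^sup>2) / (cos (a - t))\<^sup>2"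
        using pos by (simp add: field_simps)
      then have "sqrt (1 - (cos a / cos (a - t))\<^sup>2) = sqrt ((cos (a - t))\<^sup>2 - (cos a)\<^sup>2) / cos (a - t)"
        using pos by (simp add: real_sqrt_divide)
      then show ?thesis using pos by (simp add: f'_def tan_def field_simps power2_eq_square)
    qed
    ultimately show "(f has_real_derivative f' t) (at t)" by simp
  next
    fix s t assume st: "0 < s" "s \<le> t" "t < X"
    have "tan (a - t) \<le> tan (a - s)" using st x a by (intro tan_mono_le) auto
    moreover have "0 \<le> tan (a - t)" using st x a by (simp add: tan_pos_pi2_le)
    moreover have "cos (a - s) \<le> cos (a - t)" using st x a by (intro cos_monotone_0_pi_le) auto
    moreover have "0 < cos (a - s)" "cos a < cos (a - s)" using ct'[of s] st x ca by auto
    moreover have "(cos a)\<^sup>2 < (cos (a - s))\<^sup>2" using \<open>cos a < cos (a - s)\<close> ca by (simp add: power_strict_mono)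
    moreover have "(cos (a - s))\<^sup>2 \<le> (cos (a - t))\<^sup>2"
      using \<open>cos (a - s) \<le> cos (a - t)\<close> \<open>0 < cos (a - s)\<close> by (simp add: power_mono)
    ultimately show "f' t \<le> f' s" unfolding f'_def using ca
      by (intro frac_le mult_left_mono) auto
  qed (use x in auto)
  then show ?thesis by (simp add: f_def)
qed

section \<open>Chords of the unit circle and star polygons\<close>

lemma chord_point:
  fixes b a k :: real
  assumes "\<bar>k\<bar> \<le> 1"
  shows "cis b * Complex (cos a) (k * sin a) \<in> closed_segment (cis (b - a)) (cis (b + a))"
proof -
  \<comment> \<open>The vertical chord from \<open>cis (- a)\<close> to \<open>cis a\<close> has
    abscissa \<open>cos a\<close> and ordinates \<open>k * sin a\<close>; the factor
    \<open>cis b\<close> turns it into place.\<close>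
  have "cis b * Complex (cos a) (k * sin a) = (1 - (1 + k) / 2) *\<^sub>R cis (b - a) + ((1 + k) / 2) *\<^sub>R cis (b + a)"
    by (simp add: complex_eq_iff cos_add cos_diff sin_add sin_diff field_simps)
  then show ?thesis using assms unfolding closed_segment_def by (intro CollectI exI[of _ "(1 + k) / 2"]) auto
qed

text \<open>The sides of a star polygon spanned by neighbouring vertices meet on their common axis of symmetry.\<close>

lemma star_chords_meet:
  fixes a b :: real
  assumes "0 < a" "a \<le> b" "b < pi / 2"
  shows "closed_segment (cis 0) (cis (2 * b)) \<inter> closed_segment (cis (2 * a)) (cis (2 * b + 2 * a)) \<noteq> {}"
proof -
  have ca: "0 < cos a" "0 < cos b" using assms by (auto intro: cos_gt_zero_pi)
  have sb: "0 < sin b" "0 < sin a" using assms by (auto intro: sin_gt_zero)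
  \<comment> \<open>The chords are mirror images in the axis of direction \<open>b + a\<close>. The
    first has its midpoint in direction \<open>b\<close> at distance \<open>cos b\<close>, so it
    reaches the axis at offset \<open>cos b * tan a = k * sin b\<close> from that midpoint;
    \<open>a \<le> b\<close> keeps this point on the chord.\<close>
  define k where "k = tan a / tan b"
  have "tan a \<le> tan b" using assms by (intro tan_mono_le) auto
  moreover have "0 < tan a" using assms by (intro tan_gt_zero) auto
  ultimately have k: "\<bar>k\<bar> \<le> 1" by (simp add: k_def)
  have ks: "k * sin b = cos b * sin a / cos a" using ca sb by (simp add: k_def tan_def field_simps)
  define y where "y = complex_of_real (cos b / cos a) * cis (b + a)"
  have "cis b * Complex (cos b) (k * sin b) = y"
    unfolding ks y_def using ca by (simp add: complex_eq_iff cos_add sin_add field_simps)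
  moreover have "cis (b + 2 * a) * Complex (cos b) (- k * sin b) = y"
  proof -
    have e: "b + 2 * a = (b + a) + a" by simp
    have "cis (b + 2 * a) * Complex (cos b) (- k * sin b) = cis (b + a) * (cis a * Complex (cos b) (- k * sin b))"
      unfolding e cis_mult[symmetric] by (simp only: mult.assoc)
    also have "cis a * Complex (cos b) (- k * sin b) = complex_of_real (cos b / cos a)"
    proof -
      have "cos a * cos b + sin a * (cos b * sin a / cos a) = cos b / cos a"
      proof -
        have "cos a * cos b + sin a * (cos b * sin a / cos a) = cos b * ((cos a)\<^sup>2 + (sin a)\<^sup>2) / cos a"
          using ca by (simp add: field_simps power2_eq_square del: sin_cos_squared_add sin_cos_squared_add2 sin_cos_squared_add3)
        then show ?thesis by simp
      qed
      then show ?thesis using ca ks by (simp add: complex_eq_iff)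
    qed
    finally show ?thesis by (simp add: y_def)
  qed
  moreover have "b + 2 * a - b = 2 * a" "b + 2 * a + b = 2 * b + 2 * a" "b + b = 2 * b" by simp_all
  ultimately have "y \<in> closed_segment (cis 0) (cis (2 * b))" "y \<in> closed_segment (cis (2 * a)) (cis (2 * b + 2 * a))"
    using chord_point[of k b b] chord_point[of "- k" "b + 2 * a" b] k by simp_all
  then show ?thesis by blast
qed

lemma cis_period: "cis (x + 2 * pi * real k) = cis x"
  unfolding cis_mult[symmetric] by simp

lemma cis_frac_mod:
  assumes "0 < n"
  shows "cis (2 * pi * real (k mod n) / real n) = cis (2 * pi * real k / real n)"
proof -
  have "real k = real (k mod n) + real n * real (k div n)"
    by (metis mod_mult_div_eq of_nat_add of_nat_mult)
  then have "2 * pi * real k / real n = 2 * pi * real (k mod n) / real n + 2 * pi * real (k div n)"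
    using assms by (simp add: field_simps)
  then show ?thesis by (simp add: cis_period)
qed

lemma cis_frac_inj:
  assumes n: "0 < n" and eq: "cis (2 * pi * real j / real n) = cis (2 * pi * real k / real n)"
    and "j < n" "k < n"
  shows "j = k"
proof -
  have "inj_on (\<lambda>k. cis (2 * pi * real k / real n)) {..<n}"
    using Complex.bij_betw_roots_unity[OF n] by (rule bij_betw_imp_inj_on)
  then show ?thesis using assms by (auto simp: inj_on_def)
qed

text \<open>Closing up forces \<open>\<phi> = 2 * pi * m / n\<close> with \<open>2 * m < n\<close>,
  so the chain joins every \<open>m\<close>-th of \<open>n\<close> equally spaced points. Since the
  vertices are distinct, multiplication by \<open>m\<close> permutes the residues, and some side
  \<open>j\<close> starts at residue 1. For \<open>m \<ge> 2\<close> the sides from 0 to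
  \<open>m\<close> and from 1 to \<open>m + 1\<close> cross.\<close>

lemma simple_circle_polygon_angle:
  fixes \<phi> :: real
  assumes n: "3 \<le> n" and \<phi>: "0 < \<phi>" "\<phi> < pi" and closed: "cis (real n * \<phi>) = 1"
    and inj: "inj_on (\<lambda>i. cis (real i * \<phi>)) {..<n}"
    and simp: "\<And>i j. i < n \<Longrightarrow> j < n \<Longrightarrow> i \<noteq> j \<Longrightarrow>
      closed_segment (cis (real i * \<phi>)) (cis (real (i + 1) * \<phi>)) \<inter>
      closed_segment (cis (real j * \<phi>)) (cis (real (j + 1) * \<phi>)) \<subseteq>
      {cis (real i * \<phi>), cis (real (i + 1) * \<phi>)} \<inter> {cis (real j * \<phi>), cis (real (j + 1) * \<phi>)}"
  shows "\<phi> = 2 * pi / real n"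
proof -
  have "cos (real n * \<phi>) = 1" using closed by (simp add: complex_eq_iff)
  then obtain z :: int where z: "real n * \<phi> = of_int z * 2 * pi" using cos_one_2pi_int by auto
  have "0 < of_int z * 2 * pi" using z \<phi> n by (metis mult_pos_pos of_nat_0_less_iff order_less_le_trans zero_less_numeral)
  then have "0 < z" by (simp add: zero_less_mult_iff)
  define m where "m = nat z"
  have m: "real n * \<phi> = 2 * pi * real m" "1 \<le> m" using z \<open>0 < z\<close> by (auto simp: m_def)
  then have \<phi>m: "\<phi> = 2 * pi * real m / real n" using n by (simp add: field_simps)
  have "2 * pi * real m < real n * pi" using m \<phi> n by (metis less_le_trans mult_less_cancel_left_pos of_nat_0_less_iff zero_less_numeral)
  then have "real (2 * m) < real n" by simp
  then have mn: "2 * m < n" by linarith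
  have v: "cis (real i * \<phi>) = cis (2 * pi * real (i * m mod n) / real n)" for i
  proof -
    have "real i * \<phi> = 2 * pi * real (i * m) / real n" by (simp add: \<phi>m)
    then show ?thesis using cis_frac_mod[of n "i * m"] n by simp
  qed
  have "m = 1"
  proof (rule ccontr)
    assume "m \<noteq> 1"
    then have m2: "2 \<le> m" using m by simp
    have "inj_on (\<lambda>i. i * m mod n) {..<n}"
      using inj by (auto simp: inj_on_def v)
    then have "(\<lambda>i. i * m mod n) ` {..<n} = {..<n}"
      using n by (intro endo_inj_surj) auto
    moreover have "1 \<in> {..<n}" using n by simp
    ultimately have "1 \<in> (\<lambda>i. i * m mod n) ` {..<n}" by simp
    then obtain j where j: "j < n" "j * m mod n = 1" by auto
    have "j \<noteq> 0" using j by (cases j) auto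
    have "(j + 1) * m mod n = (j * m mod n + m) mod n" by (simp add: algebra_simps mod_simps)
    then have j1: "(j + 1) * m mod n = m + 1" using j mn m2 by simp
    define a where "a = pi / real n"
    have v0: "cis (real 0 * \<phi>) = cis 0" and v1: "cis (real (0 + 1) * \<phi>) = cis (2 * (real m * a))"
      by (simp_all add: \<phi>m a_def mult_ac)
    have vj: "cis (real j * \<phi>) = cis (2 * a)" using j v[of j] by (simp add: a_def)
    have vj1: "cis (real (j + 1) * \<phi>) = cis (2 * (real m * a) + 2 * a)"
    proof -
      have "2 * (real m * a) + 2 * a = 2 * pi * real (m + 1) / real n"
        by (simp add: a_def add_divide_distrib algebra_simps)
      then show ?thesis using j1 v[of "j + 1"] by simp
    qed
    have "0 < a" using n by (simp add: a_def)
    moreover have "a \<le> real m * a" using m \<open>0 < a\<close> by simp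
    moreover have "real m * a < pi / 2" using mn n by (simp add: a_def field_simps)
    ultimately have "closed_segment (cis (real 0 * \<phi>)) (cis (real (0 + 1) * \<phi>)) \<inter>
      closed_segment (cis (real j * \<phi>)) (cis (real (j + 1) * \<phi>)) \<noteq> {}"
      unfolding v0 v1 vj vj1 by (rule star_chords_meet)
    \<comment> \<open>The crossing would have to be a common vertex, but the residues
      \<open>0, m\<close> and \<open>1, m + 1\<close> are distinct because \<open>2 \<le> m\<close>
      and \<open>m + 1 < n\<close>.\<close>
    then have "{cis (real 0 * \<phi>), cis (real (0 + 1) * \<phi>)} \<inter> {cis (real j * \<phi>), cis (real (j + 1) * \<phi>)} \<noteq> {}"
      using simp[of 0 j] j n \<open>j \<noteq> 0\<close> by fastforce
    then have "\<exists>k\<in>{0, m}. \<exists>l\<in>{1, m + 1}. cis (2 * pi * real k / real n) = cis (2 * pi * real l / real n)"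
      using v[of 0] v[of 1] v[of j] v[of "j + 1"] j j1 mn by auto
    then obtain k l where "k \<in> {0, m}" "l \<in> {1, m + 1}" "cis (2 * pi * real k / real n) = cis (2 * pi * real l / real n)"
      by blast
    moreover from this have "k = l" using n mn m2 by (intro cis_frac_inj[of n k l]) auto
    ultimately show False using m2 by auto
  qed
  then show ?thesis using \<phi>m by simp
qed

section \<open>Volumes of lunes and trihedral cones\<close>

lemma lmeasurable_Int_halfspace:
  fixes a :: "'a::euclidean_space"
  assumes "S \<in> lmeasurable"
  shows "S \<inter> {x. 0 \<le> a \<bullet> x} \<in> lmeasurable" "S \<inter> {x. a \<bullet> x \<le> 0} \<in> lmeasurable"
proof -
  have "closed {x. 0 \<le> a \<bullet> x}" "closed {x. a \<bullet> x \<le> 0}"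
    by (simp_all add: closed_halfspace_ge closed_halfspace_le)
  then show "S \<inter> {x. 0 \<le> a \<bullet> x} \<in> lmeasurable" "S \<inter> {x. a \<bullet> x \<le> 0} \<in> lmeasurable"
    using assms by (auto intro!: fmeasurable_Int_fmeasurable)
qed

lemma measure_split_halfspace:
  fixes a :: "'a::euclidean_space"
  assumes S: "S \<in> lmeasurable" and a: "a \<noteq> 0"
  shows "measure lebesgue S =
    measure lebesgue (S \<inter> {x. 0 \<le> a \<bullet> x}) + measure lebesgue (S \<inter> {x. a \<bullet> x \<le> 0})"
proof -
  have "measure lebesgue ((S \<inter> {x. 0 \<le> a \<bullet> x}) \<union> (S \<inter> {x. a \<bullet> x \<le> 0})) =
    measure lebesgue (S \<inter> {x. 0 \<le> a \<bullet> x}) + measure lebesgue (S \<inter> {x. a \<bullet> x \<le> 0})"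
  proof (rule measure_Un_AE)
    have "negligible {x. a \<bullet> x = 0}" using a by (intro negligible_hyperplane) simp
    then show "AE x in lebesgue. x \<notin> S \<inter> {x. 0 \<le> a \<bullet> x} \<or> x \<notin> S \<inter> {x. a \<bullet> x \<le> 0}"
      by (auto intro!: AE_I'[of "{x. a \<bullet> x = 0}"] simp: negligible_iff_null_sets)
  qed (use lmeasurable_Int_halfspace[OF S] in auto)
  moreover have "(S \<inter> {x. 0 \<le> a \<bullet> x}) \<union> (S \<inter> {x. a \<bullet> x \<le> 0}) = S" by auto
  ultimately show ?thesis by simp
qed

lemma measure_uminus_image:
  fixes S :: "(real^'n::{finite,wellorder}) set"
  assumes "S \<in> lmeasurable"
  shows "measure lebesgue (uminus ` S) = measure lebesgue S"
  by (rule measure_orthogonal_image[OF _ assms]) (simp add: orthogonal_transformation linear_iff)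

text \<open>For an orthonormal pair this runs through the unit circle of its plane. Other circles
  are obtained by giving \<open>u\<close> and \<open>w\<close> the radius as their common
  length.\<close>

definition dir :: "'a::real_vector \<Rightarrow> 'a \<Rightarrow> real \<Rightarrow> 'a" where
  "dir u w t = cos t *\<^sub>R u + sin t *\<^sub>R w"

definition orthonormal_pair :: "'a::real_inner \<Rightarrow> 'a \<Rightarrow> bool" where
  "orthonormal_pair u w \<longleftrightarrow> u \<bullet> u = 1 \<and> w \<bullet> w = 1 \<and> u \<bullet> w = 0"

lemma orthonormal_pairD:
  assumes "orthonormal_pair u w"
  shows "u \<bullet> u = 1" "w \<bullet> w = 1" "u \<bullet> w = 0" "w \<bullet> u = 0"
  using assms by (auto simp: orthonormal_pair_def inner_commute)

lemma dir_inner: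
  assumes "orthonormal_pair u w"
  shows "dir u w s \<bullet> dir u w t = cos (s - t)"
  using orthonormal_pairD[OF assms] by (simp add: dir_def inner_simps cos_diff)

lemma dir_nonzero: "orthonormal_pair u w \<Longrightarrow> dir u w t \<noteq> 0"
  using dir_inner[of u w t t] by auto

text \<open>The rotation by \<open>\<gamma>\<close> changes only the components along
  \<open>u\<close> and \<open>w\<close> and fixes the orthogonal complement. It is described by its
  effect on the functionals \<open>dir u w t\<close>, since these cut out the wedges.\<close>

lemma rotation_in_plane:
  fixes u w :: "'a::euclidean_space"
  assumes uw: "orthonormal_pair u w"
  obtains R where "orthogonal_transformation R" "\<And>x t. dir u w (t + \<gamma>) \<bullet> R x = dir u w t \<bullet> x"
proof
  define R where "R x = x + ((cos \<gamma> - 1) * (x \<bullet> u) - sin \<gamma> * (x \<bullet> w)) *\<^sub>R u +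
    (sin \<gamma> * (x \<bullet> u) + (cos \<gamma> - 1) * (x \<bullet> w)) *\<^sub>R w" for x
  note o = orthonormal_pairD[OF uw]
  have Ru: "R x \<bullet> u = cos \<gamma> * (x \<bullet> u) - sin \<gamma> * (x \<bullet> w)"
    and Rw: "R x \<bullet> w = sin \<gamma> * (x \<bullet> u) + cos \<gamma> * (x \<bullet> w)" for x
    by (simp_all add: R_def inner_simps o algebra_simps)
  have cs: "(cos \<gamma>)\<^sup>2 + (sin \<gamma>)\<^sup>2 = 1" by simp
  have lin: "linear R" by (rule linearI) (simp_all add: R_def inner_simps algebra_simps)
  have "R x \<bullet> R x = x \<bullet> x" for x
  proof -
    define X Y where "X = x \<bullet> u" and "Y = x \<bullet> w"
    define A B where "A = (cos \<gamma> - 1) * X - sin \<gamma> * Y" and "B = sin \<gamma> * X + (cos \<gamma> - 1) * Y"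
    have "R x = x + A *\<^sub>R u + B *\<^sub>R w" by (simp add: R_def A_def B_def X_def Y_def)
    then have "R x \<bullet> R x = x \<bullet> x + (2 * A * X + 2 * B * Y + A\<^sup>2 + B\<^sup>2)"
      using o by (simp add: X_def Y_def inner_simps inner_commute power2_eq_square algebra_simps)
    also have "2 * A * X + 2 * B * Y + A\<^sup>2 + B\<^sup>2 = ((cos \<gamma>)\<^sup>2 + (sin \<gamma>)\<^sup>2 - 1) * (X\<^sup>2 + Y\<^sup>2)"
      unfolding A_def B_def by algebra
    finally show ?thesis by (simp add: algebra_simps)
  qed
  then show "orthogonal_transformation R"
    using lin by (simp add: orthogonal_transformation norm_eq_sqrt_inner)
  show "dir u w (t + \<gamma>) \<bullet> R x = dir u w t \<bullet> x" for x t
  proof -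
    have "dir u w (t + \<gamma>) \<bullet> R x = cos (t + \<gamma>) * (R x \<bullet> u) + sin (t + \<gamma>) * (R x \<bullet> w)"
      by (simp add: dir_def inner_simps inner_commute)
    also have "\<dots> = cos t * (x \<bullet> u) * ((cos \<gamma>)\<^sup>2 + (sin \<gamma>)\<^sup>2) + sin t * (x \<bullet> w) * ((cos \<gamma>)\<^sup>2 + (sin \<gamma>)\<^sup>2)"
      unfolding Ru Rw cos_add sin_add by algebra
    also have "\<dots> = dir u w t \<bullet> x" by (simp add: dir_def inner_simps inner_commute)
    finally show ?thesis .
  qed
qed

text \<open>In the angle around the plane of an orthonormal pair this is the range from
  \<open>s - pi / 2\<close> to \<open>t - pi / 2\<close>, for \<open>s \<le> t \<le> s + pi\<close>.
  The opposite signs of the two inequalities make the opening angle \<open>t - s\<close> instead of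
  its supplement.\<close>

definition ball_wedge :: "'a::euclidean_space \<Rightarrow> 'a \<Rightarrow> real \<Rightarrow> real \<Rightarrow> 'a set" where
  "ball_wedge u w s t = cball 0 1 \<inter> {x. 0 \<le> dir u w s \<bullet> x} \<inter> {x. dir u w t \<bullet> x \<le> 0}"

lemma ball_wedge_lmeasurable: "ball_wedge u w s t \<in> lmeasurable"
  unfolding ball_wedge_def by (intro lmeasurable_Int_halfspace) simp

lemma measure_ball_wedge_rotate:
  fixes u w :: "real^'n::{finite,wellorder}"
  assumes uw: "orthonormal_pair u w"
  shows "measure lebesgue (ball_wedge u w (s + \<gamma>) (t + \<gamma>)) = measure lebesgue (ball_wedge u w s t)"
proof -
  obtain R where R: "orthogonal_transformation R" "\<And>x t. dir u w (t + \<gamma>) \<bullet> R x = dir u w t \<bullet> x"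
    using rotation_in_plane[OF uw] by blast
  have "ball_wedge u w (s + \<gamma>) (t + \<gamma>) = R ` ball_wedge u w s t"
  proof (intro set_eqI iffI)
    fix y assume y: "y \<in> ball_wedge u w (s + \<gamma>) (t + \<gamma>)"
    obtain x where x: "y = R x" using orthogonal_transformation_surj[OF R(1)] by (metis surjD)
    with y show "y \<in> R ` ball_wedge u w s t"
      using R orthogonal_transformation_norm[OF R(1)] by (auto simp: ball_wedge_def)
  qed (use R orthogonal_transformation_norm[OF R(1)] in \<open>auto simp: ball_wedge_def\<close>)
  then show ?thesis using measure_orthogonal_image[OF R(1) ball_wedge_lmeasurable] by simp
qed

lemma measure_ball_wedge_add:
  fixes u w :: "real^'n::{finite,wellorder}"
  assumes uw: "orthonormal_pair u w" and \<phi>\<psi>: "0 \<le> \<phi>" "0 \<le> \<psi>" "\<phi> + \<psi> \<le> pi"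
  shows "measure lebesgue (ball_wedge u w 0 (\<phi> + \<psi>)) =
    measure lebesgue (ball_wedge u w 0 \<phi>) + measure lebesgue (ball_wedge u w 0 \<psi>)"
proof -
  have zero: "measure lebesgue (ball_wedge u w 0 0) = 0"
  proof -
    have "ball_wedge u w 0 0 \<subseteq> {x. dir u w 0 \<bullet> x = 0}" by (auto simp: ball_wedge_def)
    moreover have "negligible {x. dir u w 0 \<bullet> x = 0}"
      using dir_nonzero[OF uw] by (intro negligible_hyperplane) simp
    ultimately show ?thesis using negligible_imp_measure0 negligible_subset by blast
  qed
  show ?thesis
  proof (cases "\<phi> = 0 \<or> \<psi> = 0")
    case True
    then show ?thesis using zero by auto
  next
    case False
    then have pos: "0 < \<phi>" "0 < \<psi>" using \<phi>\<psi> by auto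
    have sp: "0 < sin \<phi>" "0 < sin \<psi>" "0 \<le> sin (\<phi> + \<psi>)"
      using pos \<phi>\<psi> by (auto intro!: sin_gt_zero sin_ge_zero)
    \<comment> \<open>Three normals in one plane are linearly dependent. The signs of the
      coefficients show that, after cutting along \<open>dir u w \<phi>\<close>, one of the two
      original inequalities follows from the other two in each piece.\<close>
    have three: "sin \<phi> * (dir u w (\<phi> + \<psi>) \<bullet> x) = sin (\<phi> + \<psi>) * (dir u w \<phi> \<bullet> x) - sin \<psi> * (dir u w 0 \<bullet> x)" for x
    proof -
      have "sin \<psi> * (u \<bullet> x) = (sin (\<phi> + \<psi>) * cos \<phi> - cos (\<phi> + \<psi>) * sin \<phi>) * (u \<bullet> x)"
        using sin_diff[of "\<phi> + \<psi>" \<phi>] by simp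
      then show ?thesis by (simp add: dir_def inner_simps algebra_simps)
    qed
    define S where "S = ball_wedge u w 0 (\<phi> + \<psi>)"
    have "S \<inter> {x. dir u w \<phi> \<bullet> x \<le> 0} = ball_wedge u w 0 \<phi>"
    proof -
      have "dir u w (\<phi> + \<psi>) \<bullet> x \<le> 0" if "0 \<le> dir u w 0 \<bullet> x" "dir u w \<phi> \<bullet> x \<le> 0" for x
      proof -
        have "sin (\<phi> + \<psi>) * (dir u w \<phi> \<bullet> x) \<le> 0" "0 \<le> sin \<psi> * (dir u w 0 \<bullet> x)"
          using sp that by (auto simp: mult_le_0_iff)
        then have "sin \<phi> * (dir u w (\<phi> + \<psi>) \<bullet> x) \<le> 0" using three[of x] by linarith
        then show ?thesis using sp by (simp add: mult_le_0_iff)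
      qed
      then show ?thesis by (auto simp: S_def ball_wedge_def)
    qed
    moreover have "S \<inter> {x. 0 \<le> dir u w \<phi> \<bullet> x} = ball_wedge u w (0 + \<phi>) (\<psi> + \<phi>)"
    proof -
      have "0 \<le> dir u w 0 \<bullet> x" if "0 \<le> dir u w \<phi> \<bullet> x" "dir u w (\<phi> + \<psi>) \<bullet> x \<le> 0" for x
      proof -
        have "sin \<phi> * (dir u w (\<phi> + \<psi>) \<bullet> x) \<le> 0" "0 \<le> sin (\<phi> + \<psi>) * (dir u w \<phi> \<bullet> x)"
          using sp that by (auto simp: mult_le_0_iff)
        then have "0 \<le> sin \<psi> * (dir u w 0 \<bullet> x)" using three[of x] by linarith
        then show ?thesis using sp by (simp add: zero_le_mult_iff)
      qed
      then show ?thesis by (auto simp: S_def ball_wedge_def add.commute)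
    qed
    ultimately show ?thesis
      using measure_split_halfspace[of S "dir u w \<phi>"] dir_nonzero[OF uw] ball_wedge_lmeasurable[of u w 0 "\<phi> + \<psi>"]
        measure_ball_wedge_rotate[OF uw, of 0 \<phi> \<psi>] by (simp add: S_def)
  qed
qed

lemma measure_half_ball:
  fixes a :: "real^'n::{finite,wellorder}"
  assumes "a \<noteq> 0"
  shows "measure lebesgue (cball 0 1 \<inter> {x. 0 \<le> a \<bullet> x}) = measure lebesgue (cball (0::real^'n::{finite,wellorder}) 1) / 2"
proof -
  have "uminus ` (cball 0 1 \<inter> {x. 0 \<le> a \<bullet> x}) = cball 0 1 \<inter> {x. a \<bullet> x \<le> 0}"
    by (auto intro!: image_eqI[of _ uminus "- _"])
  then have "measure lebesgue (cball 0 1 \<inter> {x. a \<bullet> x \<le> 0}) = measure lebesgue (cball 0 1 \<inter> {x. 0 \<le> a \<bullet> x})"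
    using measure_uminus_image[of "cball 0 1 \<inter> {x. 0 \<le> a \<bullet> x}"] lmeasurable_Int_halfspace(1)[of "cball 0 1" a] by simp
  then show ?thesis using measure_split_halfspace[of "cball 0 1" a] assms by simp
qed

text \<open>Additivity in the angle makes the volume linear, and the half ball at angle
  \<open>pi\<close> fixes the constant.\<close>

lemma measure_ball_wedge:
  fixes u w :: "real^'n::{finite,wellorder}"
  assumes uw: "orthonormal_pair u w" and \<phi>: "0 \<le> \<phi>" "\<phi> \<le> pi"
  shows "measure lebesgue (ball_wedge u w 0 \<phi>) = \<phi> / (2 * pi) * measure lebesgue (cball (0::real^'n::{finite,wellorder}) 1)"
proof -
  have "ball_wedge u w 0 pi = cball 0 1 \<inter> {x. 0 \<le> u \<bullet> x}"
    by (auto simp: ball_wedge_def dir_def)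
  moreover have "u \<noteq> 0" using orthonormal_pairD[OF uw] by auto
  ultimately have half: "measure lebesgue (ball_wedge u w 0 pi) = measure lebesgue (cball (0::real^'n::{finite,wellorder}) 1) / 2"
    using measure_half_ball[of u] by simp
  have "measure lebesgue (ball_wedge u w 0 \<phi>) = \<phi> / pi * measure lebesgue (ball_wedge u w 0 pi)"
    using measure_ball_wedge_add[OF uw] \<phi>
    by (intro additive_on_interval_linear[where g = "\<lambda>\<phi>. measure lebesgue (ball_wedge u w 0 \<phi>)"]) auto
  then show ?thesis unfolding half by simp
qed

text \<open>With \<open>\<phi>\<close> the angle between the normals, the lune is the half ball of
  \<open>a\<close> without a wedge of angle \<open>\<phi>\<close>, which leaves the dihedral angle
  \<open>pi - \<phi>\<close>. The second vector of the frame is \<open>b\<close> orthonormalised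
  against \<open>a\<close>; the strict bound on \<open>a \<bullet> b\<close> keeps
  \<open>sin \<phi>\<close> away from 0.\<close>

lemma measure_lune:
  fixes a b :: "real^'n::{finite,wellorder}"
  assumes a: "norm a = 1" and b: "norm b = 1" and ab: "\<bar>a \<bullet> b\<bar> < 1"
  shows "measure lebesgue (cball 0 1 \<inter> {x. 0 \<le> a \<bullet> x} \<inter> {x. 0 \<le> b \<bullet> x}) =
    (pi - arccos (a \<bullet> b)) / (2 * pi) * measure lebesgue (cball (0::real^'n::{finite,wellorder}) 1)"
proof -
  define \<phi> where "\<phi> = arccos (a \<bullet> b)"
  have \<phi>: "0 \<le> \<phi>" "\<phi> \<le> pi" using ab by (auto simp: \<phi>_def arccos_lbound arccos_ubound)
  have c: "cos \<phi> = a \<bullet> b" using ab by (simp add: \<phi>_def)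
  have s: "(sin \<phi>)\<^sup>2 = 1 - (a \<bullet> b)\<^sup>2" using c by (simp add: sin_squared_eq)
  moreover have "(a \<bullet> b)\<^sup>2 < 1" using ab by (simp add: abs_square_less_1)
  ultimately have s0: "sin \<phi> \<noteq> 0" by auto
  define w where "w = (b - cos \<phi> *\<^sub>R a) /\<^sub>R sin \<phi>"
  have aa: "a \<bullet> a = 1" "b \<bullet> b = 1" using a b by (simp_all add: dot_square_norm)
  have "w \<bullet> w = 1"
    using s s0 aa by (simp add: w_def c inner_simps inner_commute power2_eq_square field_simps)
  moreover have "a \<bullet> w = 0" using aa c by (simp add: w_def inner_simps)
  ultimately have uw: "orthonormal_pair a w" using aa by (simp add: orthonormal_pair_def)
  have "dir a w \<phi> = b" using s0 by (simp add: dir_def w_def)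
  then have "(cball 0 1 \<inter> {x. 0 \<le> a \<bullet> x}) \<inter> {x. b \<bullet> x \<le> 0} = ball_wedge a w 0 \<phi>"
    by (simp add: ball_wedge_def dir_def)
  moreover have "measure lebesgue (cball 0 1 \<inter> {x. 0 \<le> a \<bullet> x}) = measure lebesgue (cball (0::real^'n::{finite,wellorder}) 1) / 2"
    using aa by (intro measure_half_ball) auto
  moreover have "b \<noteq> 0" using b by auto
  ultimately have "measure lebesgue (cball 0 1 \<inter> {x. 0 \<le> a \<bullet> x} \<inter> {x. 0 \<le> b \<bullet> x}) =
    measure lebesgue (cball (0::real^'n::{finite,wellorder}) 1) / 2 - measure lebesgue (ball_wedge a w 0 \<phi>)"
    using measure_split_halfspace[of "cball 0 1 \<inter> {x. 0 \<le> a \<bullet> x}" b] lmeasurable_Int_halfspace(1)[of "cball 0 1" a] by simp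
  then show ?thesis
    unfolding measure_ball_wedge[OF uw \<phi>] by (simp add: \<phi>_def diff_divide_distrib algebra_simps)
qed

text \<open>Girard's theorem, for the trihedral cone with inward unit normals \<open>a\<close>, \<open>b\<close>, \<open>c\<close>.\<close>

lemma measure_trihedral_cone:
  fixes a b c :: "real^'n::{finite,wellorder}"
  assumes n: "norm a = 1" "norm b = 1" "norm c = 1"
    and lt: "\<bar>a \<bullet> b\<bar> < 1" "\<bar>a \<bullet> c\<bar> < 1" "\<bar>b \<bullet> c\<bar> < 1"
  shows "measure lebesgue (cball 0 1 \<inter> {x. 0 \<le> a \<bullet> x} \<inter> {x. 0 \<le> b \<bullet> x} \<inter> {x. 0 \<le> c \<bullet> x}) =
    (2 * pi - arccos (a \<bullet> b) - arccos (a \<bullet> c) - arccos (b \<bullet> c)) / (4 * pi) * measure lebesgue (cball (0::real^'n::{finite,wellorder}) 1)"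
proof -
  let ?B = "cball (0::real^'n::{finite,wellorder}) 1" and ?P = "\<lambda>a. {x::real^'n::{finite,wellorder}. 0 \<le> a \<bullet> x}" and ?N = "\<lambda>a. {x::real^'n::{finite,wellorder}. a \<bullet> x \<le> 0}"
  let ?\<mu> = "measure lebesgue"
  have nz: "a \<noteq> 0" "b \<noteq> 0" "c \<noteq> 0" using n by auto
  have m: "?B \<inter> ?P x \<in> lmeasurable" "?B \<inter> ?P x \<inter> ?P y \<in> lmeasurable" "?B \<inter> ?P x \<inter> ?N y \<in> lmeasurable" for x y
    by (intro lmeasurable_Int_halfspace lmeasurable_cball)+
  have ab: "?\<mu> (?B \<inter> ?P a \<inter> ?P b) = ?\<mu> (?B \<inter> ?P a \<inter> ?P b \<inter> ?P c) + ?\<mu> (?B \<inter> ?P a \<inter> ?P b \<inter> ?N c)"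
    using measure_split_halfspace[OF m(2) nz(3)] .
  have ac: "?\<mu> (?B \<inter> ?P a \<inter> ?P c) = ?\<mu> (?B \<inter> ?P a \<inter> ?P b \<inter> ?P c) + ?\<mu> (?B \<inter> ?P a \<inter> ?N b \<inter> ?P c)"
    using measure_split_halfspace[OF m(2)[of a c] nz(2)] by (simp add: Int_ac)
  have bc: "?\<mu> (?B \<inter> ?P b \<inter> ?P c) = ?\<mu> (?B \<inter> ?P a \<inter> ?P b \<inter> ?P c) + ?\<mu> (?B \<inter> ?N a \<inter> ?P b \<inter> ?P c)"
    using measure_split_halfspace[OF m(2)[of b c] nz(1)] by (simp add: Int_ac)
  have half: "?\<mu> (?B \<inter> ?P a) = ?\<mu> (?B \<inter> ?P a \<inter> ?P b) + ?\<mu> (?B \<inter> ?P a \<inter> ?N b)"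
    using measure_split_halfspace[OF m(1) nz(2)] .
  have an: "?\<mu> (?B \<inter> ?P a \<inter> ?N b) = ?\<mu> (?B \<inter> ?P a \<inter> ?N b \<inter> ?P c) + ?\<mu> (?B \<inter> ?P a \<inter> ?N b \<inter> ?N c)"
    using measure_split_halfspace[OF m(3) nz(3)] .
  \<comment> \<open>The three lunes cover the cone three times and each of the pieces with exactly
    one negative sign once. The half ball of \<open>a\<close> consists of the cone, two of these
    pieces, and the piece with signs \<open>+ - -\<close>, which is antipodal to the third one. The
    difference is twice the cone.\<close>
  have "uminus ` (?B \<inter> ?P a \<inter> ?N b \<inter> ?N c) = ?B \<inter> ?N a \<inter> ?P b \<inter> ?P c"
    by (auto intro!: image_eqI[of _ uminus "- _"])
  moreover have "?B \<inter> ?P a \<inter> ?N b \<inter> ?N c \<in> lmeasurable"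
    by (intro lmeasurable_Int_halfspace lmeasurable_cball)
  ultimately have anti: "?\<mu> (?B \<inter> ?N a \<inter> ?P b \<inter> ?P c) = ?\<mu> (?B \<inter> ?P a \<inter> ?N b \<inter> ?N c)"
    using measure_uminus_image by metis
  have "2 * ?\<mu> (?B \<inter> ?P a \<inter> ?P b \<inter> ?P c) = ?\<mu> (?B \<inter> ?P a \<inter> ?P b) + ?\<mu> (?B \<inter> ?P a \<inter> ?P c) + ?\<mu> (?B \<inter> ?P b \<inter> ?P c) - ?\<mu> (?B \<inter> ?P a)"
    using ab ac bc half an anti by linarith
  then show ?thesis
    unfolding measure_half_ball[OF nz(1)] measure_lune[OF n(1,2) lt(1)] measure_lune[OF n(1,3) lt(2)] measure_lune[OF n(2,3) lt(3)]
    by (simp add: add_divide_distrib diff_divide_distrib algebra_simps)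
qed

section \<open>Cones over regular polygons\<close>

text \<open>The angle \<open>\<bar>t\<bar> * pi / n\<close> keeps a distance of at least
  \<open>pi / n\<close> from both 0 and \<open>2 * pi\<close>. It is applied to the odd multiples
  that separate a vertex from the midpoint direction of a side.\<close>

lemma cos_multiple_le:
  fixes t :: real
  assumes n: "0 < n" and t: "1 \<le> \<bar>t\<bar>" "\<bar>t\<bar> \<le> 2 * real n - 1"
  shows "cos (t * (pi / real n)) \<le> cos (pi / real n)"
proof -
  define a where "a = pi / real n"
  have a: "0 < a" "real n * a = pi" using n by (auto simp: a_def)
  define s where "s = \<bar>t\<bar> * a"
  have s: "a \<le> s" "s \<le> 2 * pi - a"
  proof -
    show "a \<le> s" using t a by (simp add: s_def)
    have "s \<le> (2 * real n - 1) * a" unfolding s_def using t a by (intro mult_right_mono) auto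
    also have "\<dots> = 2 * pi - a" using a by (simp add: algebra_simps)
    finally show "s \<le> 2 * pi - a" .
  qed
  have "cos s \<le> cos a"
  proof (cases "s \<le> pi")
    case True
    then show ?thesis using s a by (intro cos_monotone_0_pi_le) auto
  next
    case False
    have "cos (2 * pi - s) \<le> cos a" using False s a by (intro cos_monotone_0_pi_le) auto
    then show ?thesis by (simp add: cos_diff)
  qed
  moreover have "cos s = cos (t * a)" by (simp add: s_def abs_if)
  ultimately show ?thesis by (simp add: a_def)
qed

lemma dir_add_inner:
  "dir u w (t + s) \<bullet> x = cos s * (dir u w t \<bullet> x) + sin s * (dir u w (t + pi / 2) \<bullet> x)"
  by (simp add: dir_def inner_simps cos_add sin_add algebra_simps)

text \<open>A chord is perpendicular to the direction \<open>t + a\<close> of its midpoint. This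
  turns the comparison of two neighbouring directions at a point into a single half-space
  condition.\<close>

lemma dir_diff_right: "dir u w t - dir u w (t + 2 * a) = (2 * sin a) *\<^sub>R dir u w (t + a - pi / 2)"
proof -
  have "dir u w (s - a) - dir u w (s + a) = (2 * sin a) *\<^sub>R dir u w (s - pi / 2)" for s
  proof -
    have "dir u w (s - a) - dir u w (s + a) = (cos (s - a) - cos (s + a)) *\<^sub>R u + (sin (s - a) - sin (s + a)) *\<^sub>R w"
      by (simp add: dir_def algebra_simps)
    moreover have "cos (s - a) - cos (s + a) = 2 * sin a * cos (s - pi / 2)" "sin (s - a) - sin (s + a) = 2 * sin a * sin (s - pi / 2)"
      by (simp_all add: cos_diff cos_add sin_diff sin_add)
    ultimately show ?thesis by (simp add: dir_def scaleR_right_distrib)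
  qed
  from this[of "t + a"] show ?thesis by (simp add: algebra_simps)
qed

lemma dir_diff_left: "dir u w t - dir u w (t - 2 * a) = (2 * sin a) *\<^sub>R dir u w (t - a + pi / 2)"
proof -
  have "dir u w (t - a + pi / 2) = - dir u w (t - a - pi / 2)"
    by (simp add: dir_def cos_diff cos_add sin_diff sin_add scaleR_left_distrib scaleR_left_diff_distrib)
  then show ?thesis using dir_diff_right[of u w "t - 2 * a" a] by (simp add: algebra_simps)
qed

lemma dir_period: "dir u w (t + 2 * pi) = dir u w t"
  by (simp add: dir_def)

text \<open>As a function of the angle, \<open>dir u w t \<bullet> x\<close> is a sinusoid, and its
  drop over a step \<open>2 * b\<close> is \<open>2 * sin b\<close> times a linear form in its value
  \<open>X\<close> and derivative \<open>Y\<close> at \<open>t\<close>. Up to the factor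
  \<open>sin (2 * a)\<close>, the form for \<open>b = j * a\<close> is a combination of those for
  the two neighbours with coefficients \<open>sin ((j + 1) * a)\<close> and
  \<open>sin ((j - 1) * a)\<close>, nonnegative for \<open>1 \<le> j < n\<close>.\<close>

lemma local_max_is_global_max:
  fixes u w x :: "'a::real_inner"
  assumes n: "3 \<le> n" and j: "j \<le> n" and a: "a = pi / real n"
    and r: "dir u w (t + 2 * a) \<bullet> x \<le> dir u w t \<bullet> x"
    and l: "dir u w (t - 2 * a) \<bullet> x \<le> dir u w t \<bullet> x"
  shows "dir u w (t + 2 * (real j * a)) \<bullet> x \<le> dir u w t \<bullet> x"
proof (cases "j = 0 \<or> j = n")
  case True
  then show ?thesis using a n dir_period[of u w t] by (auto simp: mult.commute)
next
  case False
  then have j: "1 \<le> j" "j + 1 \<le> n" using j by auto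
  have a0: "0 < a" and na: "real n * a = pi" using n a by auto
  have s: "0 < sin a" "0 < sin (2 * a)"
    using a0 na n by (auto intro!: sin_gt_zero simp: a field_simps)
  define X Y where "X = dir u w t \<bullet> x" and "Y = dir u w (t + pi / 2) \<bullet> x"
  have f: "X - dir u w (t + 2 * b) \<bullet> x = 2 * sin b * (sin b * X - cos b * Y)" for b
    unfolding dir_add_inner[of u w t "2 * b"] X_def[symmetric] Y_def[symmetric] sin_double cos_double_sin
    by (simp add: power2_eq_square algebra_simps)
  have "0 \<le> 2 * sin a * (sin a * X - cos a * Y)" using f[of a] r by (simp add: X_def)
  then have R: "0 \<le> sin a * X - cos a * Y" using s by (simp add: zero_le_mult_iff)
  have "0 \<le> 2 * sin a * (sin a * X + cos a * Y)" using f[of "- a"] l by (simp add: X_def algebra_simps)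
  then have L: "0 \<le> sin a * X + cos a * Y" using s by (simp add: zero_le_mult_iff)
  have J: "0 \<le> (real j - 1) * a" "(real j + 1) * a \<le> pi"
  proof -
    show "0 \<le> (real j - 1) * a" using j a0 by simp
    have "(real j + 1) * a \<le> real n * a" using j a0 by (intro mult_right_mono) auto
    then show "(real j + 1) * a \<le> pi" using na by simp
  qed
  have "0 \<le> sin ((real j + 1) * a)" "0 \<le> sin ((real j - 1) * a)" "0 \<le> sin (real j * a)"
    using J a0 by (auto intro!: sin_ge_zero simp: algebra_simps)
  moreover have "sin (2 * a) * (sin (real j * a) * X - cos (real j * a) * Y) =
    sin ((real j + 1) * a) * (sin a * X - cos a * Y) + sin ((real j - 1) * a) * (sin a * X + cos a * Y)"
  proof -
    have "sin ((real j + 1) * a) = sin (real j * a) * cos a + cos (real j * a) * sin a"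
      "sin ((real j - 1) * a) = sin (real j * a) * cos a - cos (real j * a) * sin a"
      by (simp_all add: ring_distribs sin_add sin_diff)
    then show ?thesis unfolding sin_double by algebra
  qed
  ultimately have "0 \<le> sin (2 * a) * (sin (real j * a) * X - cos (real j * a) * Y)"
    using R L by simp
  then have "0 \<le> sin (real j * a) * X - cos (real j * a) * Y" using s by (simp add: zero_le_mult_iff)
  then have "0 \<le> X - dir u w (t + 2 * (real j * a)) \<bullet> x"
    unfolding f using \<open>0 \<le> sin (real j * a)\<close> by simp
  then show ?thesis by (simp add: X_def)
qed

text \<open>The vertices sit at the even multiples of \<open>pi / n\<close>, so the odd ones point
  from the centre to the midpoints of the sides and are normal to them.\<close>

definition mid_dir :: "nat \<Rightarrow> 'a::real_vector \<Rightarrow> 'a \<Rightarrow> nat \<Rightarrow> 'a" where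
  "mid_dir n u w j = dir u w ((2 * real j + 1) * (pi / real n))"

lemma mid_dir_add_n: "0 < n \<Longrightarrow> mid_dir n u w (j + n) = mid_dir n u w j"
proof -
  assume "0 < n"
  then have "(2 * real (j + n) + 1) * (pi / real n) = (2 * real j + 1) * (pi / real n) + 2 * pi"
    by (simp add: field_simps)
  then show ?thesis by (simp add: mid_dir_def dir_period)
qed

lemma mid_dir_mod: "0 < n \<Longrightarrow> mid_dir n u w (j mod n) = mid_dir n u w j"
proof (induction j rule: less_induct)
  case (less j)
  then show ?case using mid_dir_add_n[of n u w "j - n"] by (cases "j < n") (auto simp: le_mod_geq)
qed

text \<open>The left-hand side describes the sector spanned by side \<open>i\<close>; on it the constraint of side \<open>i\<close>
  implies those of all other sides.\<close>

lemma sector_iff_max: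
  fixes u w x :: "'a::real_inner"
  assumes n: "3 \<le> n" and i: "i < n" and a: "a = pi / real n"
  shows "(0 \<le> dir u w ((2 * real i + 2) * a - pi / 2) \<bullet> x \<and> 0 \<le> dir u w (2 * real i * a + pi / 2) \<bullet> x) \<longleftrightarrow>
    (\<forall>j<n. mid_dir n u w j \<bullet> x \<le> mid_dir n u w i \<bullet> x)" (is "?L \<longleftrightarrow> ?R")
proof -
  define t where "t = (2 * real i + 1) * a"
  have a0: "0 < a" and na: "real n * a = pi" using n a by auto
  have s: "0 < sin a" using a0 na n by (auto intro!: sin_gt_zero simp: a field_simps)
  have mi: "mid_dir n u w i = dir u w t" by (simp add: mid_dir_def t_def a)
  have "mid_dir n u w (i + 1) = dir u w (t + 2 * a)" by (simp add: mid_dir_def t_def a algebra_simps)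
  then have right: "mid_dir n u w i - mid_dir n u w (i + 1) = (2 * sin a) *\<^sub>R dir u w ((2 * real i + 2) * a - pi / 2)"
    using dir_diff_right[of u w t a] by (simp add: mi t_def algebra_simps)
  \<comment> \<open>The predecessor of side \<open>i\<close> is written \<open>i + n - 1\<close> to
    avoid a negative index; this accounts for the extra full turn.\<close>
  have "mid_dir n u w (i + n - 1) = dir u w (t - 2 * a + 2 * pi)"
  proof -
    have "(2 * real (i + n - 1) + 1) * a = t - 2 * a + 2 * pi"
      using n na by (simp add: t_def of_nat_diff algebra_simps)
    then show ?thesis by (simp add: mid_dir_def a)
  qed
  then have "mid_dir n u w (i + n - 1) = dir u w (t - 2 * a)" by (simp only: dir_period)
  then have left: "mid_dir n u w i - mid_dir n u w (i + n - 1) = (2 * sin a) *\<^sub>R dir u w (2 * real i * a + pi / 2)"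
    using dir_diff_left[of u w t a] by (simp add: mi t_def algebra_simps)
  have L: "?L \<longleftrightarrow> mid_dir n u w (i + 1) \<bullet> x \<le> mid_dir n u w i \<bullet> x \<and> mid_dir n u w (i + n - 1) \<bullet> x \<le> mid_dir n u w i \<bullet> x"
  proof -
    have "mid_dir n u w i \<bullet> x - mid_dir n u w (i + 1) \<bullet> x = 2 * sin a * (dir u w ((2 * real i + 2) * a - pi / 2) \<bullet> x)"
      using arg_cong[OF right, of "\<lambda>v. v \<bullet> x"] by (simp add: inner_simps)
    moreover have "mid_dir n u w i \<bullet> x - mid_dir n u w (i + n - 1) \<bullet> x = 2 * sin a * (dir u w (2 * real i * a + pi / 2) \<bullet> x)"
      using arg_cong[OF left, of "\<lambda>v. v \<bullet> x"] by (simp add: inner_simps)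
    moreover have "0 \<le> 2 * sin a * y \<longleftrightarrow> 0 \<le> y" for y :: real using s by (simp add: zero_le_mult_iff)
    ultimately show ?thesis by (metis diff_ge_0_iff_ge)
  qed
  show ?thesis
  proof
    assume ?L
    then have lr: "dir u w (t + 2 * a) \<bullet> x \<le> dir u w t \<bullet> x" "dir u w (t - 2 * a) \<bullet> x \<le> dir u w t \<bullet> x"
      using L \<open>mid_dir n u w (i + 1) = dir u w (t + 2 * a)\<close> \<open>mid_dir n u w (i + n - 1) = dir u w (t - 2 * a)\<close> mi
      by simp_all
    have "mid_dir n u w (i + k) \<bullet> x \<le> mid_dir n u w i \<bullet> x" if "k \<le> n" for k
    proof -
      have "mid_dir n u w (i + k) = dir u w (t + 2 * (real k * a))"
        by (simp add: mid_dir_def t_def a algebra_simps)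
      then show ?thesis using local_max_is_global_max[OF n that a lr] mi by simp
    qed
    note k = this
    show ?R
    proof (intro allI impI)
      fix j assume j: "j < n"
      show "mid_dir n u w j \<bullet> x \<le> mid_dir n u w i \<bullet> x"
      proof (cases "i \<le> j")
        case True
        then show ?thesis using k[of "j - i"] j by simp
      next
        case False
        then show ?thesis using k[of "j + n - i"] j i mid_dir_add_n[of n u w j] by simp
      qed
    qed
  next
    assume R: ?R
    have "mid_dir n u w j \<bullet> x \<le> mid_dir n u w i \<bullet> x" for j
    proof -
      have "mid_dir n u w (j mod n) \<bullet> x \<le> mid_dir n u w i \<bullet> x" using R n by simp
      then show ?thesis using mid_dir_mod[of n u w j] n by simp
    qed
    then show ?L using L by simp
  qed
qed

text \<open>At a point \<open>x\<close> the tightest constraint belongs to the side whose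
  \<open>mid_dir n u w i \<bullet> x\<close> is largest, which sorts the cone into \<open>n\<close>
  sectors. Each is trihedral, with dihedral angle \<open>2 * a\<close> along the axis
  \<open>c\<close> and \<open>arccos (q * sin a)\<close> along the two edges through the vertices;
  the condition on \<open>p\<close> and \<open>q\<close> makes the side normals unit
  vectors.\<close>

lemma measure_regular_cone:
  fixes u w c :: "real^'k::{finite,wellorder}"
  assumes n: "3 \<le> n" and uw: "orthonormal_pair u w" and c: "c \<bullet> c = 1" "c \<bullet> u = 0" "c \<bullet> w = 0"
    and pq: "p\<^sup>2 + q\<^sup>2 = 1" "0 < p" "0 < q" and a: "a = pi / real n"
  shows "measure lebesgue (cball 0 1 \<inter> {x. \<forall>j<n. 0 \<le> (p *\<^sub>R c - q *\<^sub>R mid_dir n u w j) \<bullet> x}) =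
    real n * (2 * a + 2 * arccos (q * sin a) - pi) / (4 * pi) * measure lebesgue (cball (0::real^'k::{finite,wellorder}) 1)"
proof -
  define \<nu> where "\<nu> j = p *\<^sub>R c - q *\<^sub>R mid_dir n u w j" for j
  define A where "A i = dir u w ((2 * real i + 2) * a - pi / 2)" for i
  define B where "B i = dir u w (2 * real i * a + pi / 2)" for i
  define S where "S i = cball 0 1 \<inter> {x. 0 \<le> A i \<bullet> x} \<inter> {x. 0 \<le> B i \<bullet> x} \<inter> {x. 0 \<le> \<nu> i \<bullet> x}" for i
  have a0: "0 < a" and na: "real n * a = pi" using n a by auto
  have a3: "a \<le> pi / 3" using n by (simp add: a field_simps)
  have sa: "0 < sin a" using a0 a3 by (intro sin_gt_zero) auto
  have le: "\<nu> i \<bullet> x \<le> \<nu> j \<bullet> x \<longleftrightarrow> mid_dir n u w j \<bullet> x \<le> mid_dir n u w i \<bullet> x" for i j x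
    using pq by (simp add: \<nu>_def inner_simps)
  have sec: "0 \<le> A i \<bullet> x \<and> 0 \<le> B i \<bullet> x \<longleftrightarrow> (\<forall>j<n. mid_dir n u w j \<bullet> x \<le> mid_dir n u w i \<bullet> x)" if "i < n" for i x
    unfolding A_def B_def using sector_iff_max[OF n that a] .
  have union: "cball 0 1 \<inter> {x. \<forall>j<n. 0 \<le> \<nu> j \<bullet> x} = (\<Union>i\<in>{..<n}. S i)"
  proof (intro set_eqI iffI)
    fix x assume x: "x \<in> cball 0 1 \<inter> {x. \<forall>j<n. 0 \<le> \<nu> j \<bullet> x}"
    have "Max ((\<lambda>j. mid_dir n u w j \<bullet> x) ` {..<n}) \<in> (\<lambda>j. mid_dir n u w j \<bullet> x) ` {..<n}"
      using n by (intro Max_in) (auto simp: lessThan_empty_iff)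
    then obtain i where i: "i < n" "mid_dir n u w i \<bullet> x = Max ((\<lambda>j. mid_dir n u w j \<bullet> x) ` {..<n})" by auto
    then have "\<forall>j<n. mid_dir n u w j \<bullet> x \<le> mid_dir n u w i \<bullet> x" by simp
    then have "x \<in> S i" using x i sec by (auto simp: S_def)
    then show "x \<in> (\<Union>i\<in>{..<n}. S i)" using i by auto
  next
    fix x assume "x \<in> (\<Union>i\<in>{..<n}. S i)"
    then obtain i where i: "i < n" "x \<in> S i" by auto
    then have "0 \<le> \<nu> i \<bullet> x" "\<forall>j<n. \<nu> i \<bullet> x \<le> \<nu> j \<bullet> x" using sec[OF i(1)] by (auto simp: S_def le)
    then have "\<forall>j<n. 0 \<le> \<nu> j \<bullet> x" by (meson order_trans)
    then show "x \<in> cball 0 1 \<inter> {x. \<forall>j<n. 0 \<le> \<nu> j \<bullet> x}" using i by (auto simp: S_def)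
  qed
  \<comment> \<open>On the overlap both directions attain the maximum, so their inner products with
    \<open>x\<close> agree and \<open>x\<close> lies in a hyperplane.\<close>
  have neg: "negligible (S i \<inter> S j)" if "i < n" "j < n" "i < j" for i j
  proof -
    have "S i \<inter> S j \<subseteq> {x. (mid_dir n u w i - mid_dir n u w j) \<bullet> x = 0}"
    proof
      fix x assume x: "x \<in> S i \<inter> S j"
      then have "mid_dir n u w j \<bullet> x \<le> mid_dir n u w i \<bullet> x" using sec[of i x] that by (simp add: S_def)
      moreover have "mid_dir n u w i \<bullet> x \<le> mid_dir n u w j \<bullet> x" using x sec[of j x] that by (simp add: S_def)
      ultimately show "x \<in> {x. (mid_dir n u w i - mid_dir n u w j) \<bullet> x = 0}" by (simp add: inner_diff_left)
    qed
    moreover have "mid_dir n u w i \<noteq> mid_dir n u w j"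
    proof
      assume "mid_dir n u w i = mid_dir n u w j"
      moreover have "mid_dir n u w j \<bullet> mid_dir n u w i = cos (2 * (real (j - i) * a))"
      proof -
        have "(2 * real j + 1) * a - (2 * real i + 1) * a = 2 * (real (j - i) * a)"
          using that by (simp add: of_nat_diff algebra_simps)
        then show ?thesis by (simp only: mid_dir_def dir_inner[OF uw] a[symmetric])
      qed
      moreover have "mid_dir n u w j \<bullet> mid_dir n u w j = 1"
        by (simp add: mid_dir_def dir_inner[OF uw])
      ultimately have "sin (real (j - i) * a) = 0" by (simp add: cos_double_sin)
      moreover have "real (j - i) * a < real n * a" "0 < real (j - i) * a"
        using that a0 by (auto simp: of_nat_diff)
      then have "0 < sin (real (j - i) * a)" unfolding na by (metis sin_gt_zero)
      ultimately show False by simp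
    qed
    ultimately show ?thesis by (metis negligible_hyperplane negligible_subset right_minus_eq)
  qed
  have V: "measure lebesgue (S i) =
    (2 * a + 2 * arccos (q * sin a) - pi) / (4 * pi) * measure lebesgue (cball (0::real^'k::{finite,wellorder}) 1)" for i
  proof -
    have q1: "q < 1"
    proof (rule ccontr)
      assume "\<not> q < 1"
      then have "1 \<le> q\<^sup>2" by simp
      moreover have "0 < p\<^sup>2" using pq by simp
      ultimately show False using pq by linarith
    qed
    have qs: "0 < q * sin a" "q * sin a < 1"
      using pq sa q1 by (auto intro: less_le_trans[of "q * sin a" "1 * sin a"])
    have AB: "A i \<bullet> B i = cos (pi - 2 * a)"
    proof -
      have "(2 * real i + 2) * a - pi / 2 - (2 * real i * a + pi / 2) = - (pi - 2 * a)" by (simp add: algebra_simps)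
      then show ?thesis by (simp only: A_def B_def dir_inner[OF uw] cos_minus)
    qed
    have cd: "c \<bullet> dir u w t = 0" "dir u w t \<bullet> c = 0" for t using c by (simp_all add: dir_def inner_simps inner_commute)
    have Am: "A i \<bullet> mid_dir n u w i = sin a"
    proof -
      have "(2 * real i + 2) * a - pi / 2 - (2 * real i + 1) * a = - (pi / 2 - a)" by (simp add: algebra_simps)
      then show ?thesis by (simp only: A_def mid_dir_def a[symmetric] dir_inner[OF uw] cos_minus) (simp add: cos_diff)
    qed
    have Bm: "B i \<bullet> mid_dir n u w i = sin a"
    proof -
      have "2 * real i * a + pi / 2 - (2 * real i + 1) * a = pi / 2 - a" by (simp add: algebra_simps)
      then show ?thesis by (simp only: B_def mid_dir_def a[symmetric] dir_inner[OF uw]) (simp add: cos_diff)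
    qed
    have A\<nu>: "A i \<bullet> \<nu> i = - (q * sin a)" using Am cd by (simp add: \<nu>_def inner_simps A_def)
    have B\<nu>: "B i \<bullet> \<nu> i = - (q * sin a)" using Bm cd by (simp add: \<nu>_def inner_simps B_def)
    have nA: "norm (A i) = 1" "norm (B i) = 1" by (simp_all add: A_def B_def norm_eq_sqrt_inner dir_inner[OF uw])
    have "\<nu> i \<bullet> \<nu> i = p\<^sup>2 + q\<^sup>2"
      using cd c by (simp add: \<nu>_def inner_simps mid_dir_def dir_inner[OF uw] power2_eq_square)
    then have n\<nu>: "norm (\<nu> i) = 1" using pq by (simp add: norm_eq_sqrt_inner)
    have cpi: "cos pi < cos (pi - 2 * a)" "cos (pi - 2 * a) < cos 0"
      using a0 a3 by (intro cos_monotone_0_pi; simp)+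
    have acos: "arccos (cos (pi - 2 * a)) = pi - 2 * a" using a0 a3 by (intro arccos_cos) auto
    show ?thesis unfolding S_def
      using measure_trihedral_cone[OF nA n\<nu>] cpi qs
      by (simp only: AB A\<nu> B\<nu> acos) (simp add: arccos_minus)
  qed
  have "measure lebesgue (\<Union>i\<in>{..<n}. S i) = (\<Sum>i\<in>{..<n}. measure lebesgue (S i))"
  proof (rule measure_negligible_finite_Union_image)
    show "S i \<in> lmeasurable" for i
      unfolding S_def by (intro lmeasurable_Int_halfspace lmeasurable_cball)
    show "pairwise (\<lambda>i j. negligible (S i \<inter> S j)) {..<n}"
      using neg by (auto simp: pairwise_def) (metis Int_commute linorder_neqE_nat)
  qed simp
  then show ?thesis using union by (simp add: V \<nu>_def)
qed

section \<open>Vertices of regular polygons in the plane\<close>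

lemma vert_mod: "vert Q (i mod length (verts Q)) = vert Q i"
  by (simp add: vert_def)

lemma vert_add_length: "vert Q (i + length (verts Q)) = vert Q i"
  by (simp add: vert_def)

lemma vert_Suc_mod: "vert Q (Suc (i mod length (verts Q))) = vert Q (Suc i)"
  by (simp add: vert_def mod_simps)

lemma vert_eq_iff:
  assumes "distinct (verts Q)" "verts Q \<noteq> []"
  shows "vert Q i = vert Q j \<longleftrightarrow> i mod length (verts Q) = j mod length (verts Q)"
  using assms by (auto simp: vert_def nth_eq_iff_index_eq)

lemma vert_Suc_neq:
  assumes "distinct (verts Q)" "3 \<le> length (verts Q)"
  shows "vert Q (i + 1) \<noteq> vert Q i" "vert Q (i + 2) \<noteq> vert Q i"
proof -
  have ne: "verts Q \<noteq> []" using assms by auto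
  have "(i + k) mod length (verts Q) \<noteq> i mod length (verts Q)" if "0 < k" "k < length (verts Q)" for k
  proof
    assume "(i + k) mod length (verts Q) = i mod length (verts Q)"
    then have "length (verts Q) dvd (i + k) - i" by (metis le_add1 mod_eq_dvd_iff_nat)
    then show False using that by (auto dest: dvd_imp_le)
  qed
  from this[of 1] this[of 2] show "vert Q (i + 1) \<noteq> vert Q i" "vert Q (i + 2) \<noteq> vert Q i"
    using assms unfolding vert_eq_iff[OF assms(1) ne] by auto
qed

lemma regular_ngon_equal_sides:
  assumes reg: "regular_ngon M n Q" and n: "3 \<le> n"
  obtains s where "\<And>i. gdist M (vert Q i) (vert Q (i + 1)) = s" "perim M Q = real n * s"
proof -
  have len: "length (verts Q) = n" using reg by (simp add: regular_ngon_def)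
  obtain s where s: "\<And>i. i < n \<Longrightarrow> side_length M Q i = s" using reg by (auto simp: regular_ngon_def)
  have "gdist M (vert Q i) (vert Q (i + 1)) = s" for i
    using s[of "i mod n"] n vert_mod[of Q i] vert_Suc_mod[of Q i] by (simp add: side_length_def len)
  moreover have "perim M Q = real n * s" using s by (simp add: perim_def len)
  ultimately show ?thesis using that by blast
qed

text \<open>Polar form makes the equality of angles an equation between complex numbers. The angle
  is read at vertex \<open>i + 1\<close>, so the predecessor is \<open>i\<close> and no wrap-around
  index remains; \<open>0 \<le> \<theta>\<close> comes from the range of
  \<open>Arg2pi\<close>.\<close>

lemma regular_ngon_equal_angles:
  assumes reg: "regular_ngon M n Q" and n: "3 \<le> n"
  obtains \<theta> where "0 \<le> \<theta>" "\<theta> < pi"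
    "\<And>i. Complex (tdot M (vert Q (i + 1)) (vert Q (i + 2)) (vert Q i)) (orient M (vert Q (i + 1)) (vert Q (i + 2)) (vert Q i))
      = complex_of_real (cmod (Complex (tdot M (vert Q (i + 1)) (vert Q (i + 2)) (vert Q i))
          (orient M (vert Q (i + 1)) (vert Q (i + 2)) (vert Q i)))) * cis \<theta>"
proof -
  have len: "length (verts Q) = n" using reg by (simp add: regular_ngon_def)
  obtain \<theta> where \<theta>: "\<theta> < pi" "\<And>i. i < n \<Longrightarrow> interior_angle M Q i = \<theta>" using reg by (auto simp: regular_ngon_def)
  let ?z = "\<lambda>i. Complex (tdot M (vert Q (i + 1)) (vert Q (i + 2)) (vert Q i)) (orient M (vert Q (i + 1)) (vert Q (i + 2)) (vert Q i))"
  have A: "Arg2pi (?z i) = \<theta>" for i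
  proof -
    define k where "k = (i + 1) mod n"
    have k: "k < n" using n by (simp add: k_def)
    have "vert Q k = vert Q (i + 1)" using vert_mod[of Q "i + 1"] by (simp add: k_def len)
    moreover have "vert Q (k + 1) = vert Q (i + 2)" using vert_Suc_mod[of Q "i + 1"] by (simp add: k_def len)
    moreover have "vert Q (k + n - 1) = vert Q i"
    proof -
      have "(k + (n - 1)) mod n = (i + 1 + (n - 1)) mod n" unfolding k_def by (rule mod_add_left_eq)
      also have "\<dots> = i mod n" using n by simp
      finally show ?thesis using n by (simp add: vert_def len)
    qed
    ultimately show ?thesis using \<theta>(2)[OF k] by (simp add: interior_angle_def len Let_def)
  qed
  show ?thesis
  proof (rule that[of \<theta>])
    show "0 \<le> \<theta>" using A[of 0] Arg2pi by metis
    show "\<theta> < pi" by (rule \<theta>(1))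
    show "?z i = complex_of_real (cmod (?z i)) * cis \<theta>" for i
      using Arg2pi_eq[of "?z i"] A[of i] by (simp add: cis_conv_exp)
  qed
qed

text \<open>Carries the complex plane to the affine plane through \<open>c\<close> spanned by
  \<open>u\<close> and \<open>w\<close>, so that the analysis of circular chains in complex numbers
  serves both geometries.\<close>

definition frame_map :: "'a::real_vector \<Rightarrow> 'a \<Rightarrow> 'a \<Rightarrow> complex \<Rightarrow> 'a" where
  "frame_map c u w z = c + Re z *\<^sub>R u + Im z *\<^sub>R w"

lemma frame_map_cis: "frame_map c u w (cis t) = c + dir u w t"
  by (simp add: frame_map_def dir_def)

lemma frame_map_segment:
  assumes "z \<in> closed_segment a b"
  shows "frame_map c u w z \<in> closed_segment (frame_map c u w a) (frame_map c u w b)"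
proof -
  obtain t where t: "0 \<le> t" "t \<le> 1" "z = (1 - t) *\<^sub>R a + t *\<^sub>R b"
    using assms by (auto simp: closed_segment_def)
  have "frame_map c u w z = (1 - t) *\<^sub>R frame_map c u w a + t *\<^sub>R frame_map c u w b"
    by (simp add: frame_map_def t(3) scaleR_right_distrib scaleR_left_distrib scaleR_left_diff_distrib algebra_simps)
  then show ?thesis using t by (auto simp: closed_segment_def)
qed

lemma frame_map_inj:
  fixes c u w :: "'a::real_inner"
  assumes "u \<bullet> u \<noteq> 0" "w \<bullet> w \<noteq> 0" "u \<bullet> w = 0"
  shows "inj (frame_map c u w)"
proof (rule injI)
  fix x y assume "frame_map c u w x = frame_map c u w y"
  then have e: "Re x *\<^sub>R u + Im x *\<^sub>R w = Re y *\<^sub>R u + Im y *\<^sub>R w" by (simp add: frame_map_def algebra_simps)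
  have "Re x * (u \<bullet> u) = Re y * (u \<bullet> u)" "Im x * (w \<bullet> w) = Im y * (w \<bullet> w)"
    using arg_cong[OF e, of "\<lambda>v. v \<bullet> u"] arg_cong[OF e, of "\<lambda>v. v \<bullet> w"] assms by (simp_all add: inner_simps inner_commute)
  then show "x = y" using assms by (simp add: complex_eq_iff)
qed

lemma dir_polygon_angle:
  fixes c u w :: "'a::real_inner"
  assumes n: "3 \<le> n" and \<phi>: "0 < \<phi>" "\<phi> < pi"
    and frame: "u \<bullet> u \<noteq> 0" "w \<bullet> w \<noteq> 0" "u \<bullet> w = 0"
    and V: "\<And>i. V i = c + dir u w (real i * \<phi>)"
    and closed: "V n = V 0" and inj: "inj_on V {..<n}"
    and simp: "\<And>i j. i < n \<Longrightarrow> j < n \<Longrightarrow> i \<noteq> j \<Longrightarrow>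
      closed_segment (V i) (V (i + 1)) \<inter> closed_segment (V j) (V (j + 1)) \<subseteq> {V i, V (i + 1)} \<inter> {V j, V (j + 1)}"
  shows "\<phi> = 2 * pi / real n"
proof -
  define G where "G = frame_map c u w"
  have G: "inj G" unfolding G_def by (rule frame_map_inj[OF frame])
  have VG: "V i = G (cis (real i * \<phi>))" for i by (simp add: V G_def frame_map_cis)
  show ?thesis
  proof (rule simple_circle_polygon_angle[OF n \<phi>])
    show "cis (real n * \<phi>) = 1" using closed VG[of n] VG[of 0] G by (auto simp: inj_def)
    show "inj_on (\<lambda>i. cis (real i * \<phi>)) {..<n}" using inj VG by (auto simp: inj_on_def)
  next
    fix i j assume ij: "i < n" "j < n" "i \<noteq> j"
    show "closed_segment (cis (real i * \<phi>)) (cis (real (i + 1) * \<phi>)) \<inter>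
      closed_segment (cis (real j * \<phi>)) (cis (real (j + 1) * \<phi>)) \<subseteq>
      {cis (real i * \<phi>), cis (real (i + 1) * \<phi>)} \<inter> {cis (real j * \<phi>), cis (real (j + 1) * \<phi>)}"
    proof
      fix z assume z: "z \<in> closed_segment (cis (real i * \<phi>)) (cis (real (i + 1) * \<phi>)) \<inter>
        closed_segment (cis (real j * \<phi>)) (cis (real (j + 1) * \<phi>))"
      then have "G z \<in> closed_segment (V i) (V (i + 1)) \<inter> closed_segment (V j) (V (j + 1))"
        unfolding VG G_def by (auto intro: frame_map_segment)
      then have "G z \<in> {V i, V (i + 1)} \<inter> {V j, V (j + 1)}" using simp[OF ij] by blast
      then show "z \<in> {cis (real i * \<phi>), cis (real (i + 1) * \<phi>)} \<inter> {cis (real j * \<phi>), cis (real (j + 1) * \<phi>)}"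
        using G unfolding VG by (auto simp: inj_eq)
    qed
  qed
qed

text \<open>Complex coordinates turn equal sides and angles into \<open>e (Suc i) = - cis (- \<theta>) * e i\<close> for the
  edge vectors \<open>e\<close>, so the vertices run along a geometric progression.\<close>

lemma plane_regular_vertices:
  fixes Q :: "(real^2) polygon"
  assumes reg: "regular_ngon euclidean_plane n Q" and n: "3 \<le> n"
  obtains c :: "real^2" and u w where "u \<noteq> 0" "w = vector [- u$2, u$1]"
    "\<And>i. vert Q i = c + dir u w (real i * (2 * pi / real n))"
proof -
  have gp: "geodesic_polygon euclidean_plane Q" and len: "length (verts Q) = n"
    using reg by (auto simp: regular_ngon_def)
  have dist: "distinct (verts Q)" using gp by (simp add: geodesic_polygon_def Let_def)
  define z where "z i = Complex (vert Q i $ 1) (vert Q i $ 2)" for i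
  define e where "e i = z (i + 1) - z i" for i
  have zinj: "z i = z j \<longleftrightarrow> vert Q i = vert Q j" for i j
    by (auto simp: z_def vec_eq_iff forall_2)
  obtain s where s: "\<And>i. dist (vert Q i) (vert Q (i + 1)) = s"
    using regular_ngon_equal_sides[OF reg n] by (auto simp: euclidean_plane_def)
  have es: "cmod (e i) = s" for i
  proof -
    have "cmod (e i) = dist (vert Q i) (vert Q (i + 1))"
      by (simp add: e_def z_def dist_vec_def L2_set_def sum_2 cmod_def dist_real_def power2_commute)
    then show ?thesis using s by simp
  qed
  have e0: "e i \<noteq> 0" for i
    using vert_Suc_neq(1)[OF dist, of i] n zinj[of "i + 1" i] by (simp add: e_def len)
  obtain \<theta> where \<theta>: "0 \<le> \<theta>" "\<theta> < pi" and ang: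
    "\<And>i. Complex (tdot euclidean_plane (vert Q (i + 1)) (vert Q (i + 2)) (vert Q i)) (orient euclidean_plane (vert Q (i + 1)) (vert Q (i + 2)) (vert Q i))
      = complex_of_real (cmod (Complex (tdot euclidean_plane (vert Q (i + 1)) (vert Q (i + 2)) (vert Q i))
          (orient euclidean_plane (vert Q (i + 1)) (vert Q (i + 2)) (vert Q i)))) * cis \<theta>"
    using regular_ngon_equal_angles[OF reg n] by blast
  \<comment> \<open>Inner product and signed area of two plane vectors are the real and imaginary
    parts of \<open>cnj a * b\<close>. At vertex \<open>i + 1\<close> the vectors to the next and
    previous vertex are \<open>e (i + 1)\<close> and \<open>- e i\<close>.\<close>
  have "- cnj (e (i + 1)) * e i = complex_of_real (s\<^sup>2) * cis \<theta>" for i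
  proof -
    have "Complex (tdot euclidean_plane (vert Q (i + 1)) (vert Q (i + 2)) (vert Q i)) (orient euclidean_plane (vert Q (i + 1)) (vert Q (i + 2)) (vert Q i))
      = - cnj (e (i + 1)) * e i"
      by (simp add: euclidean_plane_def e_def z_def complex_eq_iff inner_vec_def sum_2 algebra_simps)
    moreover have "cmod (- cnj (e (i + 1)) * e i) = s\<^sup>2"
      by (simp add: norm_mult es power2_eq_square)
    ultimately show ?thesis using ang[of i] by simp
  qed
  then have "e (i + 1) * (- cnj (e (i + 1)) * e i) = complex_of_real (s\<^sup>2) * (e (i + 1) * cis \<theta>)" for i
    by (simp add: algebra_simps)
  moreover have "e (i + 1) * (- cnj (e (i + 1)) * e i) = complex_of_real (s\<^sup>2) * - e i" for i
    using complex_norm_square[of "e (i + 1)"] by (simp add: es algebra_simps)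
  moreover have "complex_of_real (s\<^sup>2) \<noteq> 0" using es[of 0] e0[of 0] by auto
  ultimately have step0: "e (i + 1) * cis \<theta> = - e i" for i by (metis mult_cancel_left)
  define \<phi> where "\<phi> = pi - \<theta>"
  have "cis \<theta> * cis \<phi> = -1" by (simp add: \<phi>_def cis_mult)
  have step: "e (i + 1) = cis \<phi> * e i" for i
  proof -
    have "e (i + 1) * (cis \<theta> * cis \<phi>) = - e i * cis \<phi>" using step0[of i] by (metis mult.assoc)
    then show ?thesis using \<open>cis \<theta> * cis \<phi> = -1\<close> by (simp add: mult.commute)
  qed
  \<comment> \<open>A zero angle would fold the second side back onto the first and identify
    vertices 0 and 2.\<close>
  have "\<theta> \<noteq> 0"
  proof
    assume "\<theta> = 0"
    then have "e 1 = - e 0" using step0[of 0] by simp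
    then have "z 2 = z 0" by (simp add: e_def numeral_2_eq_2)
    then show False using vert_Suc_neq(2)[OF dist, of 0] n zinj[of 2 0] by (simp add: len numeral_2_eq_2)
  qed
  then have \<phi>: "0 < \<phi>" "\<phi> < pi" using \<theta> by (auto simp: \<phi>_def)
  have "cos \<phi> < cos 0" using \<phi> by (intro cos_monotone_0_pi) auto
  then have \<omega>: "cis \<phi> \<noteq> 1" by (auto simp: complex_eq_iff)
  have en: "e i = cis (real i * \<phi>) * e 0" for i
  proof (induction i)
    case (Suc i)
    have "e (Suc i) = cis \<phi> * (cis (real i * \<phi>) * e 0)" using step[of i] Suc by simp
    then show ?case by (simp add: mult.assoc[symmetric] cis_mult algebra_simps)
  qed simp
  \<comment> \<open>Summing the geometric progression of the edges gives
    \<open>z i = z 0 + a * (cis (i * \<phi>) - 1)\<close>. Hence \<open>z 0 - a\<close> is the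
    centre and \<open>a\<close> the radius vector of vertex 0.\<close>
  define a where "a = e 0 / (cis \<phi> - 1)"
  have a: "a * (cis \<phi> - 1) = e 0" using \<omega> by (simp add: a_def)
  have a0: "a \<noteq> 0" using e0[of 0] a by auto
  have zn: "z i = (z 0 - a) + a * cis (real i * \<phi>)" for i
  proof (induction i)
    case (Suc i)
    have "z (Suc i) = z i + cis (real i * \<phi>) * (a * (cis \<phi> - 1))"
      using en[of i] unfolding a by (simp add: e_def algebra_simps)
    also have "\<dots> = (z 0 - a) + a * (cis (real i * \<phi>) * cis \<phi>)" using Suc by (simp add: algebra_simps)
    also have "cis (real i * \<phi>) * cis \<phi> = cis (real (Suc i) * \<phi>)" by (simp add: cis_mult algebra_simps)
    finally show ?case .
  qed simp
  define u w c where "u = (vector [Re a, Im a] :: real^2)" and "w = (vector [- Im a, Re a] :: real^2)"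
    and "c = (vector [Re (z 0 - a), Im (z 0 - a)] :: real^2)"
  have V: "vert Q i = c + dir u w (real i * \<phi>)" for i
  proof -
    have "vert Q i $ 1 = Re (z i)" "vert Q i $ 2 = Im (z i)" by (simp_all add: z_def)
    then show ?thesis unfolding zn[of i]
      by (simp add: vec_eq_iff forall_2 c_def u_def w_def dir_def algebra_simps)
  qed
  have aa: "(Re a)\<^sup>2 + (Im a)\<^sup>2 \<noteq> 0" using a0 by (simp add: complex_eq_iff sum_power2_eq_zero_iff)
  have uw: "u \<bullet> u = (Re a)\<^sup>2 + (Im a)\<^sup>2" "w \<bullet> w = (Re a)\<^sup>2 + (Im a)\<^sup>2" "u \<bullet> w = 0"
    by (simp_all add: u_def w_def inner_vec_def sum_2 power2_eq_square)
  have "\<phi> = 2 * pi / real n"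
  proof (rule dir_polygon_angle[where V = "vert Q" and c = c and u = u and w = w])
    show "vert Q n = vert Q 0" using vert_add_length[of Q 0] by (simp add: len)
    show "inj_on (vert Q) {..<n}"
    proof -
      have "verts Q \<noteq> []" using n len by auto
      then show ?thesis by (auto simp: inj_on_def vert_eq_iff[OF dist] len)
    qed
    show "closed_segment (vert Q i) (vert Q (i + 1)) \<inter> closed_segment (vert Q j) (vert Q (j + 1)) \<subseteq>
      {vert Q i, vert Q (i + 1)} \<inter> {vert Q j, vert Q (j + 1)}" if "i < n" "j < n" "i \<noteq> j" for i j
      using gp that by (auto simp: geodesic_polygon_def Let_def len side_def euclidean_plane_def)
  qed (use n \<phi> V uw aa in auto)
  moreover have "u \<noteq> 0" using uw aa by auto
  moreover have "w = vector [- u$2, u$1]" by (simp add: u_def w_def)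
  ultimately show ?thesis using that V by blast
qed

section \<open>Regular regions in the plane\<close>

lemma half_angle:
  assumes "3 \<le> n"
  shows "0 < pi / real n" "pi / real n \<le> pi / 3" "pi / real n < pi / 2" "pi / real n < pi"
proof -
  show *: "0 < pi / real n" "pi / real n \<le> pi / 3" using assms by (simp, intro frac_le) auto
  show "pi / real n < pi / 2" "pi / real n < pi" by (rule order_le_less_trans[OF *(2)]; simp)+
qed

lemma dir_inner_scaled:
  assumes "u \<bullet> u = \<rho>" "w \<bullet> w = \<rho>" "u \<bullet> w = 0"
  shows "dir u w s \<bullet> dir u w t = \<rho> * cos (s - t)"
  using assms by (simp add: dir_def inner_simps inner_commute cos_diff algebra_simps)

text \<open>The angle between the midpoint direction \<open>j\<close> and vertex \<open>i\<close> is
  the odd multiple \<open>2 * j + 1 - 2 * i\<close> of \<open>pi / n\<close>, which is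
  \<open>1\<close> or \<open>-1\<close> times it at the ends of side \<open>j\<close>. The range
  \<open>i \<le> n\<close> includes the closing copy of vertex 0.\<close>

lemma mid_dir_inner_vertex:
  fixes u w :: "'a::real_inner"
  assumes n: "3 \<le> n" and frame: "u \<bullet> u = \<rho>" "w \<bullet> w = \<rho>" "u \<bullet> w = 0"
  shows "j < n \<Longrightarrow> i \<le> n \<Longrightarrow>
      mid_dir n u w j \<bullet> dir u w (real i * (2 * pi / real n)) \<le> \<rho> * cos (pi / real n)"
    and "mid_dir n u w j \<bullet> dir u w (real j * (2 * pi / real n)) = \<rho> * cos (pi / real n)"
    and "mid_dir n u w j \<bullet> dir u w (real (j + 1) * (2 * pi / real n)) = \<rho> * cos (pi / real n)"
proof -
  have *: "mid_dir n u w j \<bullet> dir u w (real i * (2 * pi / real n)) = \<rho> * cos ((2 * real j + 1 - 2 * real i) * (pi / real n))" for i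
  proof -
    have "(2 * real j + 1) * (pi / real n) - real i * (2 * pi / real n) = (2 * real j + 1 - 2 * real i) * (pi / real n)"
      by (simp add: diff_divide_distrib left_diff_distrib)
    then show ?thesis by (simp only: mid_dir_def dir_inner_scaled[OF frame])
  qed
  show "mid_dir n u w j \<bullet> dir u w (real j * (2 * pi / real n)) = \<rho> * cos (pi / real n)"
    unfolding * by simp
  have "2 * real j + 1 - 2 * real (j + 1) = - 1" by simp
  then show "mid_dir n u w j \<bullet> dir u w (real (j + 1) * (2 * pi / real n)) = \<rho> * cos (pi / real n)"
    unfolding * by simp
  assume ij: "j < n" "i \<le> n"
  have "1 \<le> \<bar>2 * int j + 1 - 2 * int i\<bar>" by presburger
  then have "1 \<le> \<bar>of_int (2 * int j + 1 - 2 * int i) :: real\<bar>" by linarith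
  then have "1 \<le> \<bar>2 * real j + 1 - 2 * real i\<bar>" by simp
  moreover have "real j + 1 \<le> real n" using ij by linarith
  then have "\<bar>2 * real j + 1 - 2 * real i\<bar> \<le> 2 * real n - 1" using ij by (simp add: abs_le_iff)
  ultimately have "cos ((2 * real j + 1 - 2 * real i) * (pi / real n)) \<le> cos (pi / real n)"
    using n by (intro cos_multiple_le) auto
  moreover have "0 \<le> \<rho>" using frame(1) by auto
  ultimately show "mid_dir n u w j \<bullet> dir u w (real i * (2 * pi / real n)) \<le> \<rho> * cos (pi / real n)"
    unfolding * by (intro mult_left_mono)
qed

text \<open>Every side lies on its own bounding line and within all the closed half-planes. So the
  open inner polygon and the open half-plane beyond each side miss the frontier, and each is
  contained in the region or disjoint from it. An outer half-plane is unbounded and cannot be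
  contained; if the inner polygon were disjoint, the region would lie in \<open>n\<close> lines and
  have area zero.\<close>

lemma plane_regular_region:
  fixes Q :: "(real^2) polygon" and c u w :: "real^2"
  assumes reg: "regular_ngon euclidean_plane n Q" and n: "3 \<le> n"
    and frame: "u \<bullet> u = \<rho>" "w \<bullet> w = \<rho>" "u \<bullet> w = 0" and \<rho>: "0 < \<rho>"
    and V: "\<And>i. vert Q i = c + dir u w (real i * (2 * pi / real n))"
  shows "region Q = {x. \<forall>j<n. mid_dir n u w j \<bullet> (x - c) \<le> \<rho> * cos (pi / real n)}"
proof -
  define L where "L j x = \<rho> * cos (pi / real n) - mid_dir n u w j \<bullet> (x - c)" for j x
  let ?A = "region Q"
  have gp: "geodesic_polygon euclidean_plane Q" and len: "length (verts Q) = n"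
    using reg by (auto simp: regular_ngon_def)
  have comp: "compact ?A" and fr: "frontier ?A = (\<Union>i<n. closed_segment (vert Q i) (vert Q (i + 1)))"
    and area: "measure lebesgue ?A \<noteq> 0"
    using gp by (auto simp: geodesic_polygon_def Let_def euclidean_plane_def side_def len area_def)
  have ca: "0 < cos (pi / real n)" using half_angle[OF n] by (intro cos_gt_zero_pi; linarith)
  have aff: "L j ((1 - t) *\<^sub>R x + t *\<^sub>R y) = (1 - t) * L j x + t * L j y" for j t x y
    by (simp add: L_def inner_simps algebra_simps)
  have LV: "0 \<le> L j (vert Q i)" if "j < n" "i \<le> n" for i j
    using mid_dir_inner_vertex(1)[OF n frame that] by (simp add: L_def V)
  have LV0: "L j (vert Q j) = 0" "L j (vert Q (j + 1)) = 0" for j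
    using mid_dir_inner_vertex(2,3)[OF n frame] by (simp_all add: L_def V)
  have side: "0 \<le> L j x" "L i x = 0" if "x \<in> closed_segment (vert Q i) (vert Q (i + 1))" "i < n" "j < n" for i j x
  proof -
    obtain t where t: "0 \<le> t" "t \<le> 1" "x = (1 - t) *\<^sub>R vert Q i + t *\<^sub>R vert Q (i + 1)"
      using \<open>x \<in> _\<close> by (auto simp: closed_segment_def)
    show "0 \<le> L j x" "L i x = 0" using t LV[of j i] LV[of j "i + 1"] LV0[of i] that by (simp_all add: aff)
  qed
  have half: "{x. L j x < 0} = {x. mid_dir n u w j \<bullet> x > \<rho> * cos (pi / real n) + mid_dir n u w j \<bullet> c}"
    "{x. 0 < L j x} = {x. mid_dir n u w j \<bullet> x < \<rho> * cos (pi / real n) + mid_dir n u w j \<bullet> c}" for j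
    by (auto simp: L_def inner_simps)
  have sub: "0 \<le> L j x" if x: "x \<in> ?A" and j: "j < n" for j x
  proof (rule ccontr)
    assume neg: "\<not> 0 \<le> L j x"
    let ?C = "{x. L j x < 0}"
    have "convex ?C" unfolding half by (rule convex_halfspace_gt)
    then have "connected ?C" by (rule convex_connected)
    moreover have "?C \<inter> frontier ?A = {}" unfolding fr using side(1) j by force
    moreover have "x \<in> ?C \<inter> ?A" using x neg by simp
    then have "?C \<inter> ?A \<noteq> {}" by blast
    ultimately have "?C \<subseteq> ?A" using connected_Int_frontier[of ?C ?A] by blast
    moreover obtain b where b: "\<And>y. y \<in> ?A \<Longrightarrow> norm y \<le> b" using comp by (metis compact_imp_bounded bounded_iff)
    define m where "m = mid_dir n u w j"
    have mm: "m \<bullet> m = \<rho>" by (simp add: m_def mid_dir_def dir_inner_scaled[OF frame])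
    have "x + s *\<^sub>R m \<in> ?C" if "0 \<le> s" for s
    proof -
      have "L j (x + s *\<^sub>R m) = L j x - s * \<rho>" using mm by (simp add: L_def m_def inner_simps)
      then show ?thesis using neg that \<rho> by (smt (verit) mem_Collect_eq mult_nonneg_nonneg)
    qed
    ultimately have far: "norm (x + s *\<^sub>R m) \<le> b" if "0 \<le> s" for s using that b by blast
    define s where "s = (norm x + \<bar>b\<bar> + 1) / norm m"
    have m0: "0 < norm m" using mm \<rho> by (metis inner_zero_left less_irrefl zero_less_norm_iff)
    have "norm (s *\<^sub>R m) = norm x + \<bar>b\<bar> + 1" using m0 by (simp add: s_def)
    moreover have "norm (s *\<^sub>R m) \<le> norm (x + s *\<^sub>R m) + norm x"
      by (metis add_diff_cancel_left' norm_triangle_ineq4)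
    moreover have "0 \<le> s" using m0 by (simp add: s_def)
    ultimately show False using far[of s] by linarith
  qed
  define I where "I = {x. \<forall>j<n. 0 < L j x}"
  have "convex I"
  proof -
    have "I = (\<Inter>j\<in>{..<n}. {x. 0 < L j x})" by (auto simp: I_def)
    then show ?thesis unfolding half by (auto intro!: convex_INT convex_halfspace_lt)
  qed
  have Ifr: "I \<inter> frontier ?A = {}" unfolding fr I_def using side(2) by fastforce
  have "I \<subseteq> ?A"
  proof (rule ccontr)
    assume "\<not> I \<subseteq> ?A"
    then have "I \<inter> ?A = {}" using connected_Int_frontier[of I ?A] convex_connected[OF \<open>convex I\<close>] Ifr by blast
    then have "?A \<subseteq> (\<Union>j\<in>{..<n}. {x. mid_dir n u w j \<bullet> x = \<rho> * cos (pi / real n) + mid_dir n u w j \<bullet> c})"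
      using sub by (force simp: I_def L_def inner_simps)
    moreover have "mid_dir n u w j \<noteq> 0" for j
    proof -
      have "mid_dir n u w j \<bullet> mid_dir n u w j = \<rho>" by (simp add: mid_dir_def dir_inner_scaled[OF frame])
      then show ?thesis using \<rho> by auto
    qed
    then have "negligible (\<Union>j\<in>{..<n}. {x. mid_dir n u w j \<bullet> x = \<rho> * cos (pi / real n) + mid_dir n u w j \<bullet> c})"
      by (auto intro!: negligible_Union negligible_hyperplane)
    ultimately have "negligible ?A" using negligible_subset by blast
    then show False using area by (simp add: negligible_imp_measure0)
  qed
  have "x \<in> ?A" if x: "\<forall>j<n. 0 \<le> L j x" for x
  proof (cases "x = c")
    case True
    then show ?thesis using \<open>I \<subseteq> ?A\<close> \<rho> ca by (auto simp: I_def L_def)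
  next
    case False
    \<comment> \<open>The centre satisfies all constraints strictly, so \<open>x\<close> is a limit
      of points of \<open>I\<close>; the region is closed.\<close>
    have "open_segment c x \<subseteq> I"
    proof
      fix y assume "y \<in> open_segment c x"
      then obtain t where t: "0 < t" "t < 1" "y = (1 - t) *\<^sub>R c + t *\<^sub>R x" by (auto simp: in_segment)
      have "0 < L j y" if "j < n" for j
        using t x that \<rho> ca by (auto simp: aff intro!: add_pos_nonneg) (simp add: L_def)
      then show "y \<in> I" by (simp add: I_def)
    qed
    then have "closure (open_segment c x) \<subseteq> ?A"
      using \<open>I \<subseteq> ?A\<close> comp by (intro closure_minimal) (auto simp: compact_imp_closed)
    then show ?thesis using False by auto
  qed
  then have "?A = {x. \<forall>j<n. 0 \<le> L j x}" using sub by auto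
  then show ?thesis by (simp add: L_def)
qed

section \<open>Perimeter and area of regular polygons in the plane\<close>

definition unit_regular_region :: "nat \<Rightarrow> (real^2) set" where
  "unit_regular_region n = {x. \<forall>j<n. mid_dir n (axis 1 1) (axis 2 1) j \<bullet> x \<le> cos (pi / real n)}"

text \<open>The number \<open>\<rho>\<close> is the circumradius. The polygon is the image of a
  model of circumradius 1 under a similarity of determinant \<open>\<rho>\<^sup>2\<close>, and
  \<open>2 * sin (pi / n)\<close> is the side of the model.\<close>

lemma plane_regular_perim_area:
  fixes Q :: "(real^2) polygon"
  assumes reg: "regular_ngon euclidean_plane n Q" and n: "3 \<le> n"
  obtains \<rho> where "0 < \<rho>" "perim euclidean_plane Q = real n * (2 * sin (pi / real n)) * \<rho>"
    "area euclidean_plane Q = measure lebesgue (unit_regular_region n) * \<rho>\<^sup>2"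
    "0 < measure lebesgue (unit_regular_region n)"
proof -
  obtain c u w :: "real^2" where u0: "u \<noteq> 0" and w: "w = vector [- u$2, u$1]"
    and V: "\<And>i. vert Q i = c + dir u w (real i * (2 * pi / real n))"
    by (rule plane_regular_vertices[OF reg n]) (rule that; assumption)
  define a where "a = pi / real n"
  define r where "r = norm u"
  have r: "0 < r" using u0 by (simp add: r_def)
  have uu: "u \<bullet> u = r\<^sup>2" by (simp only: r_def dot_square_norm)
  have uu2: "(u$1)\<^sup>2 + (u$2)\<^sup>2 = r\<^sup>2" using uu by (simp add: inner_vec_def sum_2 power2_eq_square)
  have ww: "w \<bullet> w = r\<^sup>2" "u \<bullet> w = 0" using uu2 by (simp_all add: w inner_vec_def sum_2 power2_eq_square)
  have len: "length (verts Q) = n" using reg by (simp add: regular_ngon_def)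
  have reg_eq: "region Q = {x. \<forall>j<n. mid_dir n u w j \<bullet> (x - c) \<le> r\<^sup>2 * cos a}"
    using plane_regular_region[OF reg n uu ww _ V] r by (simp add: a_def)
  define T :: "real^2 \<Rightarrow> real^2" where "T x = x$1 *\<^sub>R u + x$2 *\<^sub>R w" for x
  have lin: "linear T" by (rule linearI) (simp_all add: T_def scaleR_left_distrib scaleR_right_distrib)
  have Tdot: "mid_dir n u w j \<bullet> T x = r\<^sup>2 * (mid_dir n (axis 1 1) (axis 2 1) j \<bullet> x)" for j x
  proof -
    have "w \<bullet> u = 0" using ww by (simp add: inner_commute)
    then show ?thesis by (simp add: mid_dir_def dir_def T_def inner_simps uu ww inner_axis' algebra_simps)
  qed
  have detT: "det (matrix T) = r\<^sup>2"
    using uu2 by (simp add: det_2 matrix_def T_def w axis_def power2_eq_square)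
  have injT: "inj T" using det_nz_iff_inj[OF lin] detT r by simp
  have surjT: "surj T" by (rule linear_inj_imp_surj[OF lin injT])
  have "region Q = (\<lambda>x. c + x) ` (T ` unit_regular_region n)"
  proof (intro set_eqI iffI)
    fix y assume y: "y \<in> region Q"
    obtain x where x: "y - c = T x" using surjT by (metis surjD)
    then have "x \<in> unit_regular_region n" using y r by (simp add: reg_eq unit_regular_region_def Tdot a_def)
    then show "y \<in> (\<lambda>x. c + x) ` (T ` unit_regular_region n)" using x unfolding image_image by (intro image_eqI[of _ _ x]) (auto simp: algebra_simps)
  next
    fix y assume "y \<in> (\<lambda>x. c + x) ` (T ` unit_regular_region n)"
    then show "y \<in> region Q" using r by (auto simp: reg_eq unit_regular_region_def Tdot a_def)
  qed
  note image = this
  \<comment> \<open>Compactness, hence measurability, of the model is pulled back from the region of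
    the given polygon.\<close>
  obtain g where g: "linear g" "g \<circ> T = id" using linear_injective_left_inverse[OF lin injT] by blast
  have "compact (region Q)" using reg by (simp add: regular_ngon_def geodesic_polygon_def Let_def)
  then have "compact ((\<lambda>x. - c + x) ` region Q)" by (rule compact_translation)
  moreover have "(\<lambda>x. - c + x) ` region Q = T ` unit_regular_region n" unfolding image by (auto simp: image_image)
  ultimately have "compact (g ` T ` unit_regular_region n)"
    using g(1) by (metis compact_continuous_image linear_continuous_on linear_conv_bounded_linear)
  then have "compact (unit_regular_region n)" using g(2) by (simp add: image_comp)
  then have lm: "unit_regular_region n \<in> lmeasurable" by (rule lmeasurable_compact)
  have meas: "measure lebesgue (region Q) = measure lebesgue (unit_regular_region n) * r\<^sup>2"
    unfolding image measure_translation using measure_linear_image[OF lin lm] detT by simp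
  have area: "area euclidean_plane Q = measure lebesgue (region Q)" by (simp add: area_def euclidean_plane_def)
  have "area euclidean_plane Q \<noteq> 0" using reg by (simp add: regular_ngon_def geodesic_polygon_def Let_def)
  then have "measure lebesgue (unit_regular_region n) \<noteq> 0" using area meas by auto
  then have pos: "0 < measure lebesgue (unit_regular_region n)" by (simp add: zero_less_measure_iff)
  obtain s where s: "\<And>i. gdist euclidean_plane (vert Q i) (vert Q (i + 1)) = s" "perim euclidean_plane Q = real n * s"
    using regular_ngon_equal_sides[OF reg n] by blast
  have "s = 2 * sin a * r"
  proof -
    have sa: "0 \<le> sin a" unfolding a_def using half_angle[OF n] by (intro sin_ge_zero; linarith)
    have "s = norm (dir u w 0 - dir u w (0 + 2 * a))"
      using s(1)[of 0] by (simp add: euclidean_plane_def V dist_norm a_def)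
    also have "\<dots> = 2 * sin a * norm (dir u w (a - pi / 2))"
      unfolding dir_diff_right using sa by simp
    also have "norm (dir u w (a - pi / 2)) = r"
      using r by (simp add: norm_eq_sqrt_inner dir_inner_scaled[OF uu ww])
    finally show ?thesis .
  qed
  then show ?thesis using that[of r] r s(2) pos meas area by (simp add: a_def)
qed

lemma plane_perim_le:
  fixes P :: "(real^2) polygon" and Ps :: "'i \<Rightarrow> (real^2) polygon"
  assumes n: "3 \<le> n" and fin: "finite I"
    and Ps: "\<And>i. i \<in> I \<Longrightarrow> regular_ngon euclidean_plane n (Ps i)" and P: "regular_ngon euclidean_plane n P"
    and area: "(\<Sum>i\<in>I. area euclidean_plane (Ps i)) = area euclidean_plane P"
  shows "perim euclidean_plane P \<le> (\<Sum>i\<in>I. perim euclidean_plane (Ps i))"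
proof -
  let ?K = "measure lebesgue (unit_regular_region n)" and ?k = "real n * (2 * sin (pi / real n))"
  obtain r where r: "0 < r" "perim euclidean_plane P = ?k * r" "area euclidean_plane P = ?K * r\<^sup>2" "0 < ?K"
    using plane_regular_perim_area[OF P n] by metis
  have "\<forall>i\<in>I. \<exists>\<rho>>0. perim euclidean_plane (Ps i) = ?k * \<rho> \<and> area euclidean_plane (Ps i) = ?K * \<rho>\<^sup>2"
    using plane_regular_perim_area[OF Ps n] by metis
  then obtain \<rho> where \<rho>: "\<And>i. i \<in> I \<Longrightarrow> 0 < \<rho> i" "\<And>i. i \<in> I \<Longrightarrow> perim euclidean_plane (Ps i) = ?k * \<rho> i"
    "\<And>i. i \<in> I \<Longrightarrow> area euclidean_plane (Ps i) = ?K * (\<rho> i)\<^sup>2" by metis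
  have "?K * (\<Sum>i\<in>I. (\<rho> i)\<^sup>2) = ?K * r\<^sup>2" using area \<rho>(3) r(3) by (simp add: sum_distrib_left)
  then have "r\<^sup>2 = (\<Sum>i\<in>I. (\<rho> i)\<^sup>2)" using r(4) by simp
  then have "r = L2_set \<rho> I" using r(1) by (simp add: L2_set_def real_sqrt_unique)
  also have "\<dots> \<le> (\<Sum>i\<in>I. \<rho> i)" using \<rho>(1) by (intro L2_set_le_sum) (auto intro: less_imp_le)
  finally have "?k * r \<le> ?k * (\<Sum>i\<in>I. \<rho> i)"
    using half_angle[OF n] by (intro mult_left_mono mult_nonneg_nonneg sin_ge_zero) (auto intro: less_imp_le)
  also have "\<dots> = (\<Sum>i\<in>I. perim euclidean_plane (Ps i))" using \<rho>(2) by (simp add: sum_distrib_left)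
  finally show ?thesis using r(2) by simp
qed

section \<open>Spherical regular chains\<close>

lemma triple_product_cyclic: "x \<bullet> cross3 y z = y \<bullet> cross3 z x"
  by (simp add: cross3_simps)

text \<open>The Gram determinant. For unit vectors it turns the square of the triple product into
  inner products and thereby fixes the modulus of the angle number at a spherical vertex.\<close>

lemma triple_product_gram:
  "(x \<bullet> cross3 y z)\<^sup>2 = (x \<bullet> x) * (y \<bullet> y) * (z \<bullet> z) + 2 * (x \<bullet> y) * (y \<bullet> z) * (x \<bullet> z)
    - (x \<bullet> x) * (y \<bullet> z)\<^sup>2 - (y \<bullet> y) * (x \<bullet> z)\<^sup>2 - (z \<bullet> z) * (x \<bullet> y)\<^sup>2"
  by (simp add: cross3_simps power2_eq_square)

text \<open>The first two conditions make \<open>d\<close> parallel to \<open>cross3 a b\<close>,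
  the third makes it orthogonal to that nonzero vector.\<close>

lemma orthogonal_to_basis_eq_0:
  assumes "d \<bullet> a = 0" "d \<bullet> b = 0" "d \<bullet> cross3 a b = 0" "cross3 a b \<noteq> 0"
  shows "d = 0"
proof -
  have "cross3 d (cross3 a b) = 0" using assms(1,2) by (simp add: Lagrange inner_commute)
  then have "0 = (norm d * norm (cross3 a b))\<^sup>2"
    using norm_cross_dot[of d "cross3 a b"] assms(3) by simp
  then show ?thesis using assms(4) by simp
qed

text \<open>For unit vectors \<open>p i\<close> forming a regular spherical chain, \<open>p (i + 2) - \<beta> *\<^sub>R p (i + 1) + p i\<close>
  is independent of \<open>i\<close> for a suitable \<open>\<beta>\<close>: the difference of two consecutive such vectors is
  orthogonal to \<open>p (i + 1)\<close>, to \<open>p (i + 2)\<close> and to their cross product. It spans the axis.\<close>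

lemma spherical_chain_on_circle:
  fixes p :: "nat \<Rightarrow> real^3"
  assumes unit: "\<And>i. p i \<bullet> p i = 1"
    and C: "\<And>i. p i \<bullet> p (Suc i) = C" "C < 1" and D: "\<And>i. p i \<bullet> p (Suc (Suc i)) = D"
    and K: "\<And>i. p i \<bullet> cross3 (p (Suc i)) (p (Suc (Suc i))) = K" "0 < K"
    and per: "0 < n" "\<And>i. p (i + n) = p i"
  obtains c u w h r \<phi> where "orthonormal_pair u w" "w = cross3 c u" "c \<bullet> c = 1" "c \<bullet> u = 0" "c \<bullet> w = 0"
    "0 < h" "0 < r" "h\<^sup>2 + r\<^sup>2 = 1" "0 < \<phi>" "\<phi> < pi" "\<And>i. p i = h *\<^sub>R c + r *\<^sub>R dir u w (real i * \<phi>)"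
proof -
  \<comment> \<open>Orthogonality of the difference to \<open>p (i + 1)\<close> reads
    \<open>D - (1 + \<beta>) * C + (1 + \<beta>) - C = 0\<close>; orthogonality to
    \<open>p (i + 2)\<close> is the same equation with the opposite sign.\<close>
  define \<beta> where "\<beta> = (C - D) / (1 - C) - 1"
  have \<beta>: "(1 + \<beta>) * (1 - C) = C - D" using C(2) by (simp add: \<beta>_def)
  define v where "v i = p (Suc (Suc i)) - \<beta> *\<^sub>R p (Suc i) + p i" for i
  have cross0: "cross3 (p i) (p (Suc i)) \<noteq> 0" for i
    using K(1)[of i] K(2) triple_product_cyclic[of "p (Suc (Suc i))" "p i" "p (Suc i)"] by auto
  have "v (Suc i) = v i" for i
  proof -
    define d where "d = v (Suc i) - v i"
    have d: "d = p (Suc (Suc (Suc i))) - (1 + \<beta>) *\<^sub>R p (Suc (Suc i)) + (1 + \<beta>) *\<^sub>R p (Suc i) - p i"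
      by (simp add: d_def v_def algebra_simps)
    have dots: "p (Suc (Suc (Suc i))) \<bullet> p (Suc i) = D" "p (Suc (Suc i)) \<bullet> p (Suc i) = C" "p (Suc (Suc (Suc i))) \<bullet> p (Suc (Suc i)) = C"
      using D[of "Suc i"] C(1)[of "Suc i"] C(1)[of "Suc (Suc i)"] by (simp_all add: inner_commute)
    have "d \<bullet> p (Suc i) = 0"
      using \<beta> C(1)[of i] unit[of "Suc i"] by (simp add: d dots inner_simps algebra_simps)
    moreover have "d \<bullet> p (Suc (Suc i)) = 0"
      using \<beta> D[of i] unit[of "Suc (Suc i)"] C(1)[of "Suc i"] by (simp add: d dots inner_simps algebra_simps)
    moreover have "d \<bullet> cross3 (p (Suc i)) (p (Suc (Suc i))) = 0"
    proof -
      have "p (Suc (Suc (Suc i))) \<bullet> cross3 (p (Suc i)) (p (Suc (Suc i))) = K"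
        using K(1)[of "Suc i"] triple_product_cyclic[of "p (Suc (Suc (Suc i)))" "p (Suc i)" "p (Suc (Suc i))"]
        by (simp)
      then show ?thesis using K(1)[of i] by (simp add: d inner_simps dot_cross_self)
    qed
    moreover have "cross3 (p (Suc i)) (p (Suc (Suc i))) \<noteq> 0" using cross0[of "Suc i"] by simp
    ultimately have "d = 0" by (rule orthogonal_to_basis_eq_0)
    then show ?thesis by (simp add: d_def)
  qed
  then have v: "v i = v 0" for i by (induction i) simp_all
  define V where "V = v 0"
  have rec: "p (Suc (Suc i)) = V + \<beta> *\<^sub>R p (Suc i) - p i" for i
    using v[of i] by (simp add: v_def V_def algebra_simps)
  have KV: "p i \<bullet> cross3 (p (Suc i)) V = K" for i
    using K(1)[of i] unfolding rec[of i]
    by (simp add: cross_add_right cross_mult_right Cross3.right_diff_distrib inner_simps dot_cross_self)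
  have V0: "V \<noteq> 0" using KV[of 0] K(2) by auto
  \<comment> \<open>The value is read off from the middle one of the three vertices that make up
    \<open>V\<close>. Periodicity makes every vertex a middle one, with \<open>i + n - 1\<close> as
    its predecessor.\<close>
  have pV: "p i \<bullet> V = 2 * C - \<beta>" for i
  proof -
    define k where "k = i + n - 1"
    have "p (Suc k) = p i" using per by (simp add: k_def)
    moreover have "p (Suc k) \<bullet> V = 2 * C - \<beta>"
    proof -
      have "V = p (Suc (Suc k)) - \<beta> *\<^sub>R p (Suc k) + p k" using v[of k] by (simp add: V_def v_def)
      then show ?thesis
        using C(1)[of k] C(1)[of "Suc k"] unit[of "Suc k"] by (simp add: inner_simps inner_commute)
    qed
    ultimately show ?thesis by simp
  qed
  define c where "c = V /\<^sub>R norm V"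
  have cc: "c \<bullet> c = 1" using V0 by (simp add: c_def dot_square_norm power2_eq_square)
  have Vc: "V = norm V *\<^sub>R c" using V0 by (simp add: c_def)
  define h where "h = (2 * C - \<beta>) / norm V"
  have pc: "p i \<bullet> c = h" for i using pV[of i] by (simp add: c_def h_def field_simps)
  define q where "q i = p i - h *\<^sub>R c" for i
  have qc: "q i \<bullet> c = 0" "c \<bullet> q i = 0" for i using pc[of i] cc by (simp_all add: q_def inner_simps inner_commute)
  have qq: "q i \<bullet> q i = 1 - h\<^sup>2" for i
    using unit[of i] pc[of i] cc by (simp add: q_def inner_simps inner_commute power2_eq_square)
  have p: "p i = h *\<^sub>R c + q i" for i by (simp add: q_def)
  have qrec0: "q (Suc (Suc i)) = \<beta> *\<^sub>R q (Suc i) - q i + (norm V + \<beta> * h - 2 * h) *\<^sub>R c" for i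
  proof -
    have "q (Suc (Suc i)) = V + \<beta> *\<^sub>R (h *\<^sub>R c + q (Suc i)) - (h *\<^sub>R c + q i) - h *\<^sub>R c"
      using rec[of i] by (simp add: q_def)
    also have "V = norm V *\<^sub>R c" by (rule Vc)
    also have "norm V *\<^sub>R c + \<beta> *\<^sub>R (h *\<^sub>R c + q (Suc i)) - (h *\<^sub>R c + q i) - h *\<^sub>R c =
      \<beta> *\<^sub>R q (Suc i) - q i + (norm V *\<^sub>R c + (\<beta> * h) *\<^sub>R c - (h *\<^sub>R c + h *\<^sub>R c))"
      by (simp add: scaleR_add_right)
    also have "norm V *\<^sub>R c + (\<beta> * h) *\<^sub>R c - (h *\<^sub>R c + h *\<^sub>R c) = (norm V + \<beta> * h - 2 * h) *\<^sub>R c"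
      by (simp only: scaleR_add_left[symmetric] scaleR_diff_left[symmetric] mult_2)
    finally show ?thesis .
  qed
  \<comment> \<open>The vectors \<open>q i\<close> have no component along \<open>c\<close>, so the
    coefficient of \<open>c\<close> in \<open>qrec0\<close> vanishes and the recurrence becomes
    homogeneous. The same equation gives \<open>0 < h\<close> once \<open>\<beta> < 2\<close> is
    known.\<close>
  have hV: "(2 - \<beta>) * h = norm V"
    using arg_cong[OF qrec0[of 0], of "\<lambda>x. x \<bullet> c"] qc cc by (simp add: inner_simps algebra_simps)
  then have qrec: "q (Suc (Suc i)) = \<beta> *\<^sub>R q (Suc i) - q i" for i using qrec0[of i] by (simp add: algebra_simps)
  have "q 0 \<noteq> 0"
  proof
    assume "q 0 = 0"
    then have "1 - h\<^sup>2 = 0" using qq[of 0] by simp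
    then have "q (Suc 0) = 0" using qq[of "Suc 0"] by simp
    then have "p 0 = p (Suc 0)" using \<open>q 0 = 0\<close> p by simp
    then show False using C(1)[of 0] C(2) unit[of 0] by simp
  qed
  define r where "r = norm (q 0)"
  have r: "0 < r" "r\<^sup>2 = 1 - h\<^sup>2" using \<open>q 0 \<noteq> 0\<close> qq[of 0] by (simp_all add: r_def power2_norm_eq_inner)
  define u where "u = q 0 /\<^sub>R r"
  define w where "w = cross3 c u"
  have q0: "q 0 = r *\<^sub>R u" using r by (simp add: u_def)
  have uu: "u \<bullet> u = 1" using qq[of 0] r by (simp add: u_def power2_eq_square field_simps)
  have cu: "c \<bullet> u = 0" "u \<bullet> c = 0" using qc by (simp_all add: u_def)
  have cw: "c \<bullet> w = 0" "w \<bullet> c = 0" "u \<bullet> w = 0" "w \<bullet> u = 0"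
    by (simp_all add: w_def dot_cross_self)
  have "(norm w)\<^sup>2 = 1" using norm_cross_dot[of c u] cu cc uu by (simp add: w_def norm_eq_sqrt_inner)
  then have ww: "w \<bullet> w = 1" by (simp add: power2_norm_eq_inner)
  have uw: "cross3 u w = c" using cu uu by (simp add: w_def Lagrange)
  have expand: "x = (x \<bullet> u) *\<^sub>R u + (x \<bullet> w) *\<^sub>R w" if "x \<bullet> c = 0" for x
  proof -
    have "x - ((x \<bullet> u) *\<^sub>R u + (x \<bullet> w) *\<^sub>R w) = 0"
      using that cu cw uu ww cc by (intro orthogonal_to_basis_eq_0[of _ u w]) (auto simp: inner_simps uw)
    then show ?thesis by simp
  qed
  define X Y where "X = q (Suc 0) \<bullet> u" and "Y = q (Suc 0) \<bullet> w"
  have q1: "q (Suc 0) = X *\<^sub>R u + Y *\<^sub>R w" unfolding X_def Y_def by (rule expand[OF qc(1)])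
  have XY: "X\<^sup>2 + Y\<^sup>2 = r\<^sup>2"
    using qq[of "Suc 0"] r(2) uu ww cw by (simp add: q1 inner_simps power2_eq_square)
  \<comment> \<open>Positive \<open>K\<close> means that the chain turns counterclockwise about
    \<open>V\<close>; this selects the sign of \<open>sin \<phi>\<close>.\<close>
  have "0 < Y"
  proof -
    have "c \<bullet> cross3 (p 0) (p (Suc 0)) = r * Y"
      by (simp add: p q0 q1 cross_add_left cross_add_right cross_mult_left cross_mult_right inner_simps dot_cross_self uw cc)
    moreover have "norm V * (c \<bullet> cross3 (p 0) (p (Suc 0))) = K"
    proof -
      have "V \<bullet> cross3 (p 0) (p (Suc 0)) = K"
        using KV[of 0] triple_product_cyclic[of V "p 0" "p (Suc 0)"] by simp
      then show ?thesis by (metis Vc inner_scaleR_left)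
    qed
    ultimately have "0 < norm V * (r * Y)" using K(2) by simp
    then show ?thesis using V0 r by (simp add: zero_less_mult_iff)
  qed
  define \<phi> where "\<phi> = arccos (X / r)"
  have "X\<^sup>2 < r\<^sup>2" using XY \<open>0 < Y\<close> by (smt (verit) zero_less_power)
  then have "\<bar>X\<bar> < r" using r by (metis abs_le_square_iff abs_of_pos not_le)
  then have Xr: "-1 < X / r" "X / r < 1" using r by (auto simp: field_simps abs_less_iff)
  then have \<phi>: "0 < \<phi>" "\<phi> < pi" using arccos_lt_bounded[of "X / r"] by (auto simp: \<phi>_def)
  have cos\<phi>: "X = r * cos \<phi>" using Xr r by (simp add: \<phi>_def)
  have "(r * sin \<phi>)\<^sup>2 = Y\<^sup>2"
  proof -
    have "(r * sin \<phi>)\<^sup>2 = r\<^sup>2 - (r * cos \<phi>)\<^sup>2" by (simp add: sin_squared_eq power_mult_distrib algebra_simps)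
    then show ?thesis using XY cos\<phi> by simp
  qed
  moreover have "0 \<le> r * sin \<phi>" using r \<phi> by (simp add: sin_ge_zero)
  ultimately have sin\<phi>: "Y = r * sin \<phi>" using \<open>0 < Y\<close> by (metis less_imp_le power2_eq_imp_eq)
  \<comment> \<open>Obtained from the inner product of
    \<open>q 2 + q 0 = \<beta> *\<^sub>R q 1\<close> with \<open>q 1\<close>. With this coefficient
    the recurrence is the one satisfied by rotation through \<open>\<phi>\<close>.\<close>
  have \<beta>\<phi>: "\<beta> = 2 * cos \<phi>"
  proof -
    have e: "q i \<bullet> q (Suc i) = C - h\<^sup>2" for i
      using C(1)[of i] pc[of i] pc[of "Suc i"] cc by (simp add: q_def inner_simps inner_commute power2_eq_square)
    have "q (Suc (Suc 0)) + q 0 = \<beta> *\<^sub>R q (Suc 0)" using qrec[of 0] by simp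
    from arg_cong[OF this, of "\<lambda>x. x \<bullet> q (Suc 0)"] have "2 * (C - h\<^sup>2) = \<beta> * r\<^sup>2"
      using e[of 0] e[of "Suc 0"] qq[of "Suc 0"] r(2) by (simp add: inner_simps inner_commute)
    moreover have "C - h\<^sup>2 = r\<^sup>2 * cos \<phi>"
      using e[of 0] uu cw by (simp add: q0 q1 inner_simps cos\<phi> power2_eq_square algebra_simps)
    ultimately show ?thesis using r(1) by simp
  qed
  have step: "dir u w (t + \<phi>) = \<beta> *\<^sub>R dir u w t - dir u w (t - \<phi>)" for t
  proof -
    have "dir u w (t + \<phi>) + dir u w (t - \<phi>) =
      (cos (t + \<phi>) + cos (t - \<phi>)) *\<^sub>R u + (sin (t + \<phi>) + sin (t - \<phi>)) *\<^sub>R w"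
      by (simp add: dir_def algebra_simps)
    also have "cos (t + \<phi>) + cos (t - \<phi>) = \<beta> * cos t" by (simp add: \<beta>\<phi> cos_add cos_diff)
    also have "sin (t + \<phi>) + sin (t - \<phi>) = \<beta> * sin t" by (simp add: \<beta>\<phi> sin_add sin_diff)
    finally show ?thesis by (simp add: dir_def scaleR_right_distrib eq_diff_eq)
  qed
  have q: "q i = r *\<^sub>R dir u w (real i * \<phi>) \<and> q (Suc i) = r *\<^sub>R dir u w (real (Suc i) * \<phi>)" for i
  proof (induction i)
    case 0
    show ?case by (simp add: q0 q1 dir_def cos\<phi> sin\<phi> scaleR_right_distrib)
  next
    case (Suc i)
    have "q (Suc (Suc i)) = r *\<^sub>R (\<beta> *\<^sub>R dir u w (real (Suc i) * \<phi>) - dir u w (real i * \<phi>))"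
      using Suc qrec[of i] by (simp add: scaleR_right_diff_distrib mult.commute)
    also have "\<dots> = r *\<^sub>R dir u w (real (Suc i) * \<phi> + \<phi>)"
    proof -
      have "real (Suc i) * \<phi> - \<phi> = real i * \<phi>" by (simp add: algebra_simps)
      then show ?thesis unfolding step[of "real (Suc i) * \<phi>"] by simp
    qed
    finally show ?case using Suc by (simp add: algebra_simps)
  qed
  have "cos \<phi> < 1" using \<phi> cos_monotone_0_pi[of 0 \<phi>] by simp
  then have "0 < 2 - \<beta>" by (simp add: \<beta>\<phi>)
  then have "0 < h" using hV V0 by (metis zero_less_mult_iff zero_less_norm_iff not_less_iff_gr_or_eq)
  moreover have "h\<^sup>2 + r\<^sup>2 = 1" using r by simp
  moreover have "p i = h *\<^sub>R c + r *\<^sub>R dir u w (real i * \<phi>)" for i using p[of i] q[of i] by simp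
  moreover have "orthonormal_pair u w" using uu ww cw by (simp add: orthonormal_pair_def)
  ultimately show ?thesis using w_def cc cu cw r \<phi> by (intro that[of u w c h r \<phi>]) simp_all
qed

text \<open>With sides and angles equal, the Gram identity gives the angle number at every vertex
  the same modulus \<open>1 - C\<^sup>2\<close>. Hence the inner products of second neighbours and
  the triple products of consecutive vertices are constant, which is what places the chain on a
  circle. The bound \<open>\<theta> < pi\<close> makes the triple product positive and so excludes
  great circles.\<close>

lemma sphere_regular_vertices:
  fixes Q :: "(real^3) polygon"
  assumes reg: "regular_ngon unit_sphere n Q" and n: "3 \<le> n"
  obtains c u w h r where "orthonormal_pair u w" "w = cross3 c u" "c \<bullet> c = 1" "c \<bullet> u = 0" "c \<bullet> w = 0"
    "0 < h" "0 < r" "h\<^sup>2 + r\<^sup>2 = 1" "\<And>i. vert Q i = h *\<^sub>R c + r *\<^sub>R dir u w (real i * (2 * pi / real n))"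
proof -
  define p where "p = vert Q"
  have gp: "geodesic_polygon unit_sphere Q" and len: "length (verts Q) = n"
    using reg by (auto simp: regular_ngon_def)
  have dist: "distinct (verts Q)" and pts: "set (verts Q) \<subseteq> sphere 0 1"
    using gp by (auto simp: geodesic_polygon_def Let_def unit_sphere_def)
  have neq: "p (i + 1) \<noteq> p i" "p (i + 2) \<noteq> p i" for i
    using vert_Suc_neq[OF dist] n by (simp_all add: len p_def)
  have "p i \<in> set (verts Q)" for i using n by (simp add: p_def vert_def len)
  then have nrm: "norm (p i) = 1" for i using pts by (meson mem_sphere_0 subsetD)
  then have unit: "p i \<bullet> p i = 1" for i by (simp add: norm_eq_1)
  obtain s where s: "\<And>i. arccos (p i \<bullet> p (i + 1)) = s"
    using regular_ngon_equal_sides[OF reg n] by (auto simp: unit_sphere_def p_def)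
  define C where "C = cos s"
  have C: "p i \<bullet> p (i + 1) = C" for i
    using s[of i] Cauchy_Schwarz_ineq2[of "p i" "p (i + 1)"] nrm by (metis C_def cos_arccos_abs mult_1)
  have eqI: "x = y" if "x \<bullet> x = 1" "y \<bullet> y = 1" "x \<bullet> y = 1" for x y :: "real^3"
  proof -
    have "(x - y) \<bullet> (x - y) = 0" using that by (simp add: inner_simps inner_commute)
    then show ?thesis by simp
  qed
  have "C \<le> 1" "-1 \<le> C" by (simp_all add: C_def)
  moreover have "C \<noteq> 1" using eqI[OF unit unit, of 1 0] C[of 0] neq(1)[of 0] by (auto simp: inner_commute)
  moreover have "C \<noteq> - 1"
  proof
    assume "C = - 1"
    then have "p (i + 1) = - p i" for i
      using eqI[of "p (i + 1)" "- p i"] unit C[of i] by (simp add: inner_commute)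
    from this[of 0] this[of 1] show False using neq(2)[of 0] by (simp add: numeral_2_eq_2)
  qed
  ultimately have C1: "C < 1" "-1 < C" by auto
  obtain \<theta> where \<theta>: "0 \<le> \<theta>" "\<theta> < pi" and ang:
    "\<And>i. Complex (tdot unit_sphere (p (i + 1)) (p (i + 2)) (p i)) (orient unit_sphere (p (i + 1)) (p (i + 2)) (p i))
      = complex_of_real (cmod (Complex (tdot unit_sphere (p (i + 1)) (p (i + 2)) (p i))
          (orient unit_sphere (p (i + 1)) (p (i + 2)) (p i)))) * cis \<theta>"
    using regular_ngon_equal_angles[OF reg n] unfolding p_def by blast
  have C2: "0 < 1 - C\<^sup>2" using C1 by (simp add: abs_square_less_1 abs_less_iff)
  have both: "p i \<bullet> p (i + 2) - C\<^sup>2 = (1 - C\<^sup>2) * cos \<theta> \<and> p i \<bullet> cross3 (p (i + 1)) (p (i + 2)) = (1 - C\<^sup>2) * sin \<theta>" for i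
  proof -
    define T O' where "T = p i \<bullet> p (i + 2) - C\<^sup>2" and "O' = p i \<bullet> cross3 (p (i + 1)) (p (i + 2))"
    have C': "p (i + 1) \<bullet> p (i + 2) = C" using C[of "i + 1"] by simp
    have t: "tdot unit_sphere (p (i + 1)) (p (i + 2)) (p i) = T"
      using C[of i] C' unit[of "i + 1"]
      by (simp add: T_def unit_sphere_def inner_simps inner_commute power2_eq_square)
    have o: "orient unit_sphere (p (i + 1)) (p (i + 2)) (p i) = O'"
      unfolding O'_def by (simp add: unit_sphere_def triple_product_cyclic[of "p i"])
    have "T\<^sup>2 + O'\<^sup>2 = (1 - C\<^sup>2)\<^sup>2"
      unfolding T_def O'_def triple_product_gram unit C[of i] C' by algebra
    then have "cmod (Complex T O') = 1 - C\<^sup>2" using C2 by (simp add: cmod_def)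
    then have "Complex T O' = complex_of_real (1 - C\<^sup>2) * cis \<theta>" using ang[of i] unfolding t o by simp
    then show ?thesis by (simp add: complex_eq_iff T_def O'_def)
  qed
  have "\<theta> \<noteq> 0"
  proof
    assume "\<theta> = 0"
    then have "p 0 \<bullet> p (Suc (Suc 0)) = 1" using both[of 0] by simp
    then show False using eqI[OF unit unit, of 0 "Suc (Suc 0)"] neq(2)[of 0] by simp
  qed
  then have K: "0 < (1 - C\<^sup>2) * sin \<theta>" using C2 \<theta> by (simp add: sin_gt_zero)
  have per: "p (i + n) = p i" for i using vert_add_length[of Q i] by (simp add: p_def len)
  obtain c u w h r \<phi> where f: "orthonormal_pair u w" "w = cross3 c u" "c \<bullet> c = 1" "c \<bullet> u = 0" "c \<bullet> w = 0"
    "0 < h" "0 < r" "h\<^sup>2 + r\<^sup>2 = 1" and \<phi>: "0 < \<phi>" "\<phi> < pi"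
    and V: "\<And>i. p i = h *\<^sub>R c + r *\<^sub>R dir u w (real i * \<phi>)"
  proof (rule spherical_chain_on_circle[of p C "C\<^sup>2 + (1 - C\<^sup>2) * cos \<theta>" "(1 - C\<^sup>2) * sin \<theta>" n])
    show "p i \<bullet> p (Suc i) = C" for i using C[of i] by simp
    show "p i \<bullet> p (Suc (Suc i)) = C\<^sup>2 + (1 - C\<^sup>2) * cos \<theta>"
      "p i \<bullet> cross3 (p (Suc i)) (p (Suc (Suc i))) = (1 - C\<^sup>2) * sin \<theta>" for i using both[of i] by simp_all
  qed (use unit C1 K per n in auto)
  note o = orthonormal_pairD[OF f(1)]
  have V': "p i = h *\<^sub>R c + dir (r *\<^sub>R u) (r *\<^sub>R w) (real i * \<phi>)" for i
    by (simp add: V dir_def scaleR_right_distrib mult.commute)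
  have pc: "p i \<bullet> c = h" for i
    using f(3-5) by (simp add: V dir_def inner_simps inner_commute)
  have "\<phi> = 2 * pi / real n"
  proof (rule dir_polygon_angle[OF n \<phi>, where V = p and c = "h *\<^sub>R c" and u = "r *\<^sub>R u" and w = "r *\<^sub>R w"])
    show "p n = p 0" using per[of 0] by simp
    show "inj_on p {..<n}"
    proof -
      have "verts Q \<noteq> []" using n len by auto
      then show ?thesis by (auto simp: inj_on_def p_def vert_eq_iff[OF dist] len)
    qed
    \<comment> \<open>Simplicity is known for the arcs but needed for the chords. A common point of
      two chords projects radially to a common vertex; chord points and vertices have the same
      height \<open>h\<close> over the axis, so the projection does not move the point.\<close>
    show "closed_segment (p i) (p (i + 1)) \<inter> closed_segment (p j) (p (j + 1)) \<subseteq>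
      {p i, p (i + 1)} \<inter> {p j, p (j + 1)}" if ij: "i < n" "j < n" "i \<noteq> j" for i j
    proof
      fix x assume x: "x \<in> closed_segment (p i) (p (i + 1)) \<inter> closed_segment (p j) (p (j + 1))"
      have "side unit_sphere Q i \<inter> side unit_sphere Q j = {p i, p (i + 1)} \<inter> {p j, p (j + 1)}"
        using gp ij by (auto simp: geodesic_polygon_def Let_def len p_def)
      moreover have "sgn x \<in> side unit_sphere Q i \<inter> side unit_sphere Q j"
        using x by (auto simp: side_def unit_sphere_def p_def)
      ultimately have sx: "sgn x \<in> {p i, p (i + 1)} \<inter> {p j, p (j + 1)}" by simp
      obtain t where "x = (1 - t) *\<^sub>R p i + t *\<^sub>R p (i + 1)" using x by (auto simp: closed_segment_def)
      then have "x \<bullet> c = (1 - t) * h + t * h" by (simp only: inner_add_left inner_scaleR_left pc)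
      then have "x \<bullet> c = h" by (simp add: algebra_simps)
      moreover have "sgn x \<bullet> c = h" using sx pc by auto
      ultimately have "norm x = 1" using f(6) by (cases "x = 0") (auto simp: sgn_div_norm field_simps)
      then have "sgn x = x" by (simp add: sgn_div_norm)
      then show "x \<in> {p i, p (i + 1)} \<inter> {p j, p (j + 1)}" using sx by simp
    qed
  qed (use f(7) V' o in auto)
  then show ?thesis using f V by (intro that[of u w c h r]) (auto simp: p_def)
qed

text \<open>The cross product is normal to the plane of side \<open>i\<close>. For
  \<open>0 < r\<close> and \<open>n \<ge> 3\<close> its scalar factor is positive, so the left side
  of the arc is where the bracketed vector has positive inner product.\<close>

lemma cross_consecutive_vertices:
  fixes c u w :: "real^3"
  assumes f: "orthonormal_pair u w" "w = cross3 c u" "c \<bullet> c = 1" "c \<bullet> u = 0"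
  shows "cross3 (h *\<^sub>R c + r *\<^sub>R dir u w (real i * (2 * pi / real n))) (h *\<^sub>R c + r *\<^sub>R dir u w (real (i + 1) * (2 * pi / real n))) =
    (2 * r * sin (pi / real n)) *\<^sub>R ((r * cos (pi / real n)) *\<^sub>R c - h *\<^sub>R mid_dir n u w i)"
proof -
  define a s where "a = pi / real n" and "s = real i * (2 * pi / real n)"
  note o = orthonormal_pairD[OF f(1)]
  have cw: "cross3 c w = - u" "cross3 u w = c" using f o by (simp_all add: Lagrange inner_commute)
  have cu: "cross3 c u = w" using f by simp
  have wu: "cross3 w c = u" "cross3 w u = - c" "cross3 u c = - w"
    using cw cu cross_skew[of w c] cross_skew[of w u] cross_skew[of u c] by simp_all
  have cd: "cross3 c (dir u w t) = dir u w (t + pi / 2)" "cross3 (dir u w t) c = - dir u w (t + pi / 2)" for t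
    by (simp_all add: dir_def cross_add_right cross_add_left cross_mult_right cross_mult_left cw cu wu cos_add sin_add)
  have dd: "cross3 (dir u w s) (dir u w t) = sin (t - s) *\<^sub>R c" for s t
    by (simp add: dir_def cross_add_right cross_add_left cross_mult_right cross_mult_left cw cu wu sin_diff
        scaleR_left_diff_distrib mult.commute)
  have "real (i + 1) * (2 * pi / real n) = s + 2 * a" by (simp add: s_def a_def distrib_right add_divide_distrib)
  then have "cross3 (h *\<^sub>R c + r *\<^sub>R dir u w (real i * (2 * pi / real n))) (h *\<^sub>R c + r *\<^sub>R dir u w (real (i + 1) * (2 * pi / real n))) =
    cross3 (h *\<^sub>R c + r *\<^sub>R dir u w s) (h *\<^sub>R c + r *\<^sub>R dir u w (s + 2 * a))" by (simp only: s_def)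
  also have "\<dots> = (r\<^sup>2 * sin (2 * a)) *\<^sub>R c - (h * r) *\<^sub>R (dir u w (s + pi / 2) - dir u w (s + pi / 2 + 2 * a))"
    by (simp add: cross_add_right cross_add_left cross_mult_right cross_mult_left cd dd power2_eq_square algebra_simps)
  also have "\<dots> = (r\<^sup>2 * sin (2 * a)) *\<^sub>R c - (h * r) *\<^sub>R (2 * sin a) *\<^sub>R dir u w (s + a)"
    unfolding dir_diff_right by (simp add: algebra_simps)
  also have "dir u w (s + a) = mid_dir n u w i"
  proof -
    have "s + a = (2 * real i + 1) * (pi / real n)"
      by (simp add: s_def a_def add_divide_distrib distrib_right)
    then show ?thesis by (simp add: mid_dir_def)
  qed
  also have "(r\<^sup>2 * sin (2 * a)) *\<^sub>R c - (h * r) *\<^sub>R (2 * sin a) *\<^sub>R mid_dir n u w i =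
    (2 * r * sin a) *\<^sub>R ((r * cos a) *\<^sub>R c - h *\<^sub>R mid_dir n u w i)"
    unfolding sin_double by (simp add: scaleR_right_diff_distrib power2_eq_square mult_ac)
  finally show ?thesis by (simp add: a_def)
qed

section \<open>Regular regions on the sphere\<close>

lemma sgn_image_eq:
  fixes S :: "'a::real_normed_vector set"
  assumes "\<And>x t. x \<in> S \<Longrightarrow> 0 < t \<Longrightarrow> t *\<^sub>R x \<in> S" "0 \<notin> S"
  shows "sgn ` S = S \<inter> sphere 0 1"
proof (intro set_eqI iffI)
  fix y assume "y \<in> sgn ` S"
  then obtain x where x: "x \<in> S" "y = sgn x" by auto
  then have "x \<noteq> 0" using assms(2) by auto
  then show "y \<in> S \<inter> sphere 0 1" using x assms(1)[of x "inverse (norm x)"] by (simp add: sgn_div_norm)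
next
  fix y assume "y \<in> S \<inter> sphere 0 1"
  then show "y \<in> sgn ` S" by (intro image_eqI[of _ _ y]) (auto simp: sgn_div_norm)
qed

text \<open>The radial projection \<open>sgn\<close> is continuous away from 0 and maps the cone
  onto its trace on the sphere.\<close>

lemma connected_convex_cone_Int_sphere:
  fixes S :: "'a::real_normed_vector set"
  assumes "convex S" "\<And>x t. x \<in> S \<Longrightarrow> 0 < t \<Longrightarrow> t *\<^sub>R x \<in> S" "0 \<notin> S"
  shows "connected (S \<inter> sphere 0 1)"
proof -
  have "connected (sgn ` S)"
    using assms(3) by (intro connected_continuous_image convex_connected assms(1) continuous_on_sgn continuous_on_id) auto
  then show ?thesis using sgn_image_eq[OF assms(2,3)] by simp
qed

text \<open>The open inner polygon \<open>I\<close> and its complementary open part \<open>E\<close>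
  are connected and miss the sides; \<open>E\<close> is a union of open hemispheres that share the
  point \<open>- c\<close>. The left-hand condition at a point of side 0 puts \<open>I\<close>
  inside the region. If \<open>E\<close> were inside as well, the region would be the whole sphere,
  whose frontier is empty.\<close>

lemma sphere_regular_region:
  fixes Q :: "(real^3) polygon" and c u w :: "real^3"
  assumes reg: "regular_ngon unit_sphere n Q" and n: "3 \<le> n"
    and f: "orthonormal_pair u w" "w = cross3 c u" "c \<bullet> c = 1" "c \<bullet> u = 0" "c \<bullet> w = 0"
    and hr: "0 < h" "0 < r" "h\<^sup>2 + r\<^sup>2 = 1"
    and V: "\<And>i. vert Q i = h *\<^sub>R c + r *\<^sub>R dir u w (real i * (2 * pi / real n))"
  shows "region Q = {x \<in> sphere 0 1. \<forall>j<n. 0 \<le> ((r * cos (pi / real n)) *\<^sub>R c - h *\<^sub>R mid_dir n u w j) \<bullet> x}"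
proof -
  define a where "a = pi / real n"
  define N where "N j = (r * cos a) *\<^sub>R c - h *\<^sub>R mid_dir n u w j" for j
  let ?S = "sphere (0::real^3) 1" and ?A = "region Q"
  note o = orthonormal_pairD[OF f(1)]
  have sa: "0 < sin a" and ca: "0 < cos a"
    using half_angle[OF n] unfolding a_def by (auto intro!: sin_gt_zero cos_gt_zero_pi)
  have gp: "geodesic_polygon unit_sphere Q" and len: "length (verts Q) = n"
    using reg by (auto simp: regular_ngon_def)
  have n0: "0 < n" using n by simp
  have comp: "compact ?A" and AS: "?A \<subseteq> ?S"
    and fr: "top_of_set ?S frontier_of ?A = (\<Union>i<n. side unit_sphere Q i)"
    using gp by (auto simp: geodesic_polygon_def Let_def len unit_sphere_def)
  have left: "\<exists>e>0. {y \<in> ?S. dist x y < e \<and> 0 < orient unit_sphere (vert Q 0) (vert Q 1) y} \<subseteq> ?A"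
    if "x \<in> side unit_sphere Q 0 - {vert Q 0, vert Q 1}" for x
    using gp that n0 unfolding geodesic_polygon_def Let_def len
    by (simp add: unit_sphere_def)
  have orient: "orient unit_sphere (vert Q 0) (vert Q 1) y = (2 * r * sin a) * (N 0 \<bullet> y)" for y
  proof -
    have "orient unit_sphere (vert Q 0) (vert Q 1) y = y \<bullet> cross3 (vert Q 0) (vert Q (0 + 1))"
      using triple_product_cyclic[of y "vert Q 0" "vert Q 1"] by (simp add: unit_sphere_def)
    also have "cross3 (vert Q 0) (vert Q (0 + 1)) = (2 * r * sin a) *\<^sub>R N 0"
      unfolding V cross_consecutive_vertices[OF f(1-4)] by (simp add: N_def a_def)
    finally show ?thesis by (simp add: inner_commute)
  qed
  have cd: "c \<bullet> dir u w t = 0" "dir u w t \<bullet> c = 0" for t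
    using f(4,5) by (simp_all add: dir_def inner_simps inner_commute)
  have NV: "N j \<bullet> vert Q i = h * r * (cos a - mid_dir n u w j \<bullet> dir u w (real i * (2 * pi / real n)))" for i j
    using f(3) cd by (simp add: N_def V inner_simps mid_dir_def algebra_simps)
  have vert_nonneg: "0 \<le> N j \<bullet> vert Q i" if "j < n" "i \<le> n" for i j
    using mid_dir_inner_vertex(1)[OF n o(1-3) that] hr by (simp add: NV a_def)
  have vert_zero: "N j \<bullet> vert Q j = 0" "N j \<bullet> vert Q (j + 1) = 0" for j
    using mid_dir_inner_vertex(2,3)[OF n o(1-3)] by (simp_all add: NV a_def del: of_nat_Suc)
  have Nc: "N j \<bullet> c = r * cos a" for j
    using f(3) cd by (simp add: N_def inner_simps mid_dir_def)
  have Nc0: "0 < N j \<bullet> c" for j using hr ca by (simp add: Nc)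
  have nrmc: "norm c = 1" using f(3) by (simp add: norm_eq_1)
  have side: "0 \<le> N j \<bullet> x" "N i \<bullet> x = 0" if "x \<in> side unit_sphere Q i" "i < n" "j < n" for i j x
  proof -
    obtain y t where t: "0 \<le> t" "t \<le> 1" "y = (1 - t) *\<^sub>R vert Q i + t *\<^sub>R vert Q (i + 1)" "x = y /\<^sub>R norm y"
      using \<open>x \<in> _\<close> by (auto simp: closed_segment_def side_def unit_sphere_def sgn_div_norm)
    show "0 \<le> N j \<bullet> x" "N i \<bullet> x = 0"
      using t vert_nonneg[of j i] vert_nonneg[of j "i + 1"] vert_zero[of i] that by (simp_all add: inner_simps)
  qed
  define I where "I = {x. \<forall>j<n. 0 < N j \<bullet> x} \<inter> ?S"
  define E where "E = (\<Union>j\<in>{..<n}. {x. N j \<bullet> x < 0} \<inter> ?S)"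
  have "connected I" unfolding I_def
  proof (rule connected_convex_cone_Int_sphere)
    have "{x. \<forall>j<n. 0 < N j \<bullet> x} = (\<Inter>j\<in>{..<n}. {x. N j \<bullet> x > 0})" by auto
    then show "convex {x. \<forall>j<n. 0 < N j \<bullet> x}" by (auto intro!: convex_INT convex_halfspace_gt)
  qed (use n0 in auto)
  have "connected E" unfolding E_def
  proof (rule connected_Union)
    show "connected s" if "s \<in> (\<lambda>j. {x. N j \<bullet> x < 0} \<inter> ?S) ` {..<n}" for s
      using that by (auto intro!: connected_convex_cone_Int_sphere convex_halfspace_lt simp: mult_pos_neg)
    have "- c \<in> {x. N j \<bullet> x < 0} \<inter> ?S" for j using Nc0[of j] nrmc by simp
    then show "\<Inter> ((\<lambda>j. {x. N j \<bullet> x < 0} \<inter> ?S) ` {..<n}) \<noteq> {}" by blast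
  qed
  have conn: "T \<subseteq> ?A \<or> T \<inter> ?A = {}"
    if "connected T" "T \<subseteq> ?S" "\<And>i x. i < n \<Longrightarrow> x \<in> side unit_sphere Q i \<Longrightarrow> x \<notin> T" for T
  proof -
    have "connectedin (top_of_set ?S) T" using that by (simp add: connectedin_subtopology)
    then show ?thesis using connectedin_Int_frontier_of[of "top_of_set ?S" T ?A] that(3) unfolding fr by blast
  qed
  have IA: "I \<subseteq> ?A \<or> I \<inter> ?A = {}"
    using side(2) by (intro conn[OF \<open>connected I\<close>]) (fastforce simp: I_def)+
  have EA: "E \<subseteq> ?A \<or> E \<inter> ?A = {}"
    using side(1) by (intro conn[OF \<open>connected E\<close>]) (fastforce simp: E_def)+
  \<comment> \<open>A small shift towards \<open>c\<close>, where all constraints are strict,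
    followed by normalisation, moves a boundary point into \<open>I\<close>.\<close>
  have limit: "\<exists>g. (\<forall>k. g k \<in> I) \<and> g \<longlonglongrightarrow> x" if x: "norm x = 1" "\<forall>j<n. 0 \<le> N j \<bullet> x" for x
  proof (intro exI conjI allI)
    define g where "g k = x + inverse (real (Suc k)) *\<^sub>R c" for k
    have pos: "0 < N j \<bullet> g k" if "j < n" for j k
      using x(2) that Nc0[of j] by (simp add: g_def inner_simps add_nonneg_pos)
    show "sgn (g k) \<in> I" for k
    proof -
      have "g k \<noteq> 0" using pos[of 0 k] n0 by auto
      then show ?thesis using pos[of _ k] by (auto simp: I_def sgn_div_norm norm_inverse)
    qed
    have "g \<longlonglongrightarrow> x + 0 *\<^sub>R c" unfolding g_def
      by (intro tendsto_intros LIMSEQ_inverse_real_of_nat)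
    moreover have "x \<noteq> 0" using x by auto
    ultimately have "(\<lambda>k. sgn (g k)) \<longlonglongrightarrow> sgn x" by (intro tendsto_sgn) auto
    then show "(\<lambda>k. sgn (g k)) \<longlonglongrightarrow> x" using x by (simp add: sgn_div_norm)
  qed
  have "I \<subseteq> ?A"
  proof -
    \<comment> \<open>The left-hand condition holds only away from the endpoints, so the midpoint of
      side 0 is taken. Were it a vertex, equal heights over the axis would give
      \<open>norm y = 2\<close>, and the two vertices would coincide.\<close>
    define y where "y = vert Q 0 + vert Q 1"
    define x where "x = sgn y"
    have Vc: "vert Q i \<bullet> c = h" for i
      using f(3) cd by (simp add: V inner_add_left)
    then have yc: "y \<bullet> c = 2 * h" by (simp add: y_def inner_add_left)
    have y0: "y \<noteq> 0" using yc hr by auto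
    have nx: "norm x = 1" using y0 by (simp add: x_def norm_sgn)
    have xs: "x \<in> side unit_sphere Q 0"
    proof -
      have "x = sgn ((1 - 1 / 2) *\<^sub>R vert Q 0 + (1 / 2) *\<^sub>R vert Q 1)"
        by (simp add: x_def y_def sgn_scaleR flip: scaleR_add_right)
      then show ?thesis by (auto simp: side_def unit_sphere_def closed_segment_def intro!: image_eqI exI[of _ "1 / 2"])
    qed
    have "vert Q 0 \<noteq> vert Q 1"
      using vert_Suc_neq(1)[of Q 0] gp n by (auto simp: geodesic_polygon_def Let_def len)
    moreover have "vert Q 0 = vert Q 1" if "x = vert Q 0 \<or> x = vert Q 1"
    proof -
      have "x \<bullet> c = h" using that Vc by auto
      then have "norm y = 2" using yc hr y0 by (simp add: x_def sgn_div_norm field_simps)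
      then have "y = 2 *\<^sub>R x" using y0 by (simp add: x_def sgn_div_norm)
      then show ?thesis using that by (auto simp: y_def scaleR_2)
    qed
    ultimately have "x \<in> side unit_sphere Q 0 - {vert Q 0, vert Q 1}" using xs by auto
    then obtain e where e: "0 < e" "{y \<in> ?S. dist x y < e \<and> 0 < orient unit_sphere (vert Q 0) (vert Q 1) y} \<subseteq> ?A"
      using left by blast
    obtain g where g: "\<And>k. g k \<in> I" "g \<longlonglongrightarrow> x" using limit[OF nx] side(1)[OF xs n0] by blast
    obtain k where "dist (g k) x < e" using metric_LIMSEQ_D[OF g(2) e(1)] by blast
    moreover have "0 < orient unit_sphere (vert Q 0) (vert Q 1) (g k)"
      unfolding orient using g(1)[of k] n0 hr sa by (simp add: I_def)
    moreover have "g k \<in> ?S" using g(1)[of k] by (simp add: I_def)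
    ultimately have "g k \<in> ?A" using e(2) by (simp only: dist_commute subset_iff mem_Collect_eq)
    then show ?thesis using IA g(1)[of k] by blast
  qed
  have sub: "x \<in> ?A" if x: "norm x = 1" "\<forall>j<n. 0 \<le> N j \<bullet> x" for x
  proof -
    obtain g where g: "\<And>k. g k \<in> I" "g \<longlonglongrightarrow> x" using limit[OF x] by blast
    then have "\<And>k. g k \<in> ?A" using \<open>I \<subseteq> ?A\<close> by blast
    with g(2) show ?thesis by (metis closed_sequentially compact_imp_closed comp)
  qed
  have "E \<inter> ?A = {}"
  proof (rule ccontr)
    assume "E \<inter> ?A \<noteq> {}"
    then have "E \<subseteq> ?A" using EA by blast
    have "x \<in> ?A" if "x \<in> ?S" for x
    proof (cases "x \<in> E")
      case True
      then show ?thesis using \<open>E \<subseteq> ?A\<close> by blast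
    next
      case False
      then have "\<forall>j<n. 0 \<le> N j \<bullet> x" using that by (auto simp: E_def not_less)
      then show ?thesis using sub that by simp
    qed
    then have "?A = topspace (top_of_set ?S)" using AS by auto
    then have "top_of_set ?S frontier_of ?A = {}" by (metis frontier_of_topspace)
    moreover have "side unit_sphere Q 0 \<noteq> {}" by (simp add: side_def unit_sphere_def)
    ultimately show False using n0 unfolding fr by blast
  qed
  have "0 \<le> N j \<bullet> x" if "x \<in> ?A" "j < n" for j x
  proof (rule ccontr)
    assume "\<not> 0 \<le> N j \<bullet> x"
    then have "x \<in> {x. N j \<bullet> x < 0} \<inter> ?S" using that(1) AS by auto
    then have "x \<in> E" using that(2) by (auto simp: E_def)
    then show False using \<open>E \<inter> ?A = {}\<close> that(1) by blast
  qed
  then have "?A = {x \<in> ?S. \<forall>j<n. 0 \<le> N j \<bullet> x}" using AS sub by auto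
  then show ?thesis by (simp add: N_def a_def)
qed

section \<open>Perimeter and area of regular polygons on the sphere\<close>

lemma sphere_regular_perim_area:
  fixes Q :: "(real^3) polygon"
  assumes reg: "regular_ngon unit_sphere n Q" and n: "3 \<le> n"
  defines "x \<equiv> area unit_sphere Q / (2 * real n)" and "a \<equiv> pi / real n"
  shows "0 < x" "x < a" "perim unit_sphere Q = 2 * real n * arccos (cos a / cos (a - x))"
proof -
  obtain c u w h r where f: "orthonormal_pair u w" "w = cross3 c u" "c \<bullet> c = 1" "c \<bullet> u = 0" "c \<bullet> w = 0"
    and hr: "0 < h" "0 < r" "h\<^sup>2 + r\<^sup>2 = 1"
    and V: "\<And>i. vert Q i = h *\<^sub>R c + r *\<^sub>R dir u w (real i * (2 * pi / real n))"
    by (rule sphere_regular_vertices[OF reg n]) (rule that; assumption)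
  have a: "0 < a" "a < pi / 2" using half_angle[OF n] by (simp_all add: a_def)
  have sa: "0 < sin a" and ca: "0 < cos a"
    using a by (auto intro!: sin_gt_zero cos_gt_zero_pi)
  \<comment> \<open>This number has two roles: it is the norm of the side normals
    \<open>N j\<close>, and it is the distance of the chord midpoints from the origin, which is the
    cosine of half a side.\<close>
  define R where "R = sqrt (h\<^sup>2 + r\<^sup>2 * (cos a)\<^sup>2)"
  have R2: "R\<^sup>2 = h\<^sup>2 + r\<^sup>2 * (cos a)\<^sup>2" by (simp add: R_def)
  have R0: "0 < R" using hr by (simp add: R_def add_pos_nonneg)
  have cs: "(sin a)\<^sup>2 + (cos a)\<^sup>2 = 1" by simp
  have "(cos a)\<^sup>2 < 1" using cs sa by (smt (verit) zero_less_power)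
  then have "R\<^sup>2 < 1" using R2 hr by (smt (verit) mult_less_cancel_left1 mult_less_cancel_left_pos zero_less_power)
  then have R1: "R < 1" using R0 by (simp add: power2_less_1_iff abs_less_iff)
  define p q where "p = r * cos a / R" and "q = h / R"
  have pq: "p\<^sup>2 + q\<^sup>2 = 1" "0 < p" "0 < q"
  proof -
    show "0 < p" "0 < q" using hr ca R0 by (simp_all add: p_def q_def)
    have "p\<^sup>2 + q\<^sup>2 = (r\<^sup>2 * (cos a)\<^sup>2 + h\<^sup>2) / R\<^sup>2"
      by (simp add: p_def q_def power_divide power_mult_distrib add_divide_distrib)
    also have "\<dots> = 1" using R2 R0 by (simp add: add.commute flip: R2)
    finally show "p\<^sup>2 + q\<^sup>2 = 1" .
  qed
  have q1: "q < 1"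
  proof -
    have "0 < p\<^sup>2" using pq by simp
    then have "q\<^sup>2 < 1" using pq(1) by linarith
    then have "q\<^sup>2 < 1\<^sup>2" by simp
    then show ?thesis by (rule power2_less_imp_less) simp
  qed
  define N where "N j = (r * cos a) *\<^sub>R c - h *\<^sub>R mid_dir n u w j" for j
  have Npq: "0 \<le> N j \<bullet> y \<longleftrightarrow> 0 \<le> (p *\<^sub>R c - q *\<^sub>R mid_dir n u w j) \<bullet> y" for j y
  proof -
    have "(p *\<^sub>R c - q *\<^sub>R mid_dir n u w j) \<bullet> y = (N j \<bullet> y) / R"
      using R0 by (simp add: N_def p_def q_def inner_simps diff_divide_distrib)
    then show ?thesis using R0 by (simp add: zero_le_divide_iff)
  qed
  have A: "region Q = {x \<in> sphere 0 1. \<forall>j<n. 0 \<le> N j \<bullet> x}"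
    unfolding N_def a_def by (rule sphere_regular_region[OF reg n f hr V])
  have "c \<in> region Q"
  proof -
    have "N j \<bullet> c = r * cos a" for j
      using f(3,4,5) by (simp add: N_def inner_simps mid_dir_def dir_def inner_commute)
    then show ?thesis using hr ca f(3) by (simp add: A norm_eq_1)
  qed
  have cone: "{t *\<^sub>R x |t x. 0 \<le> t \<and> t \<le> 1 \<and> x \<in> region Q} = cball 0 1 \<inter> {x. \<forall>j<n. 0 \<le> N j \<bullet> x}"
  proof (intro set_eqI iffI)
    fix y assume y: "y \<in> cball 0 1 \<inter> {x. \<forall>j<n. 0 \<le> N j \<bullet> x}"
    show "y \<in> {t *\<^sub>R x |t x. 0 \<le> t \<and> t \<le> 1 \<and> x \<in> region Q}"
    proof (cases "y = 0")
      case True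
      then have "y = 0 *\<^sub>R c" by simp
      then show ?thesis using \<open>c \<in> region Q\<close> by fastforce
    next
      case False
      then have "y = norm y *\<^sub>R (y /\<^sub>R norm y)" "y /\<^sub>R norm y \<in> region Q" using y by (auto simp: A)
      then show ?thesis
        using y by (intro CollectI exI[of _ "norm y"] exI[of _ "y /\<^sub>R norm y"]) simp
    qed
  qed (auto simp: A)
  have vol: "measure lebesgue (cball (0::real^3) 1) = 4 / 3 * pi"
    using content_cball[of 1 "0::real^3"] by (simp add: unit_ball_vol_3)
  have area: "area unit_sphere Q = real n * (2 * a + 2 * arccos (q * sin a) - pi)"
  proof -
    have "area unit_sphere Q = 3 * measure lebesgue (cball 0 1 \<inter> {x. \<forall>j<n. 0 \<le> (p *\<^sub>R c - q *\<^sub>R mid_dir n u w j) \<bullet> x})"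
      by (simp add: area_def unit_sphere_def cone Npq)
    also have "\<dots> = 3 * (real n * (2 * a + 2 * arccos (q * sin a) - pi) / (4 * pi) * (4 / 3 * pi))"
      unfolding vol[symmetric] by (subst measure_regular_cone[OF n f(1,3-5) pq a_def[THEN meta_eq_to_obj_eq]]) simp
    finally show ?thesis by simp
  qed
  \<comment> \<open>Half the interior angle. The bounds \<open>0 < q < 1\<close> give
    \<open>pi / 2 - a < B < pi / 2\<close>, which is \<open>0 < x < a\<close>.\<close>
  define B where "B = arccos (q * sin a)"
  have xB: "x = a + B - pi / 2" using n by (simp add: x_def area B_def field_simps)
  have qs: "0 < q * sin a" "q * sin a < sin a" "q * sin a < 1"
  proof -
    show "0 < q * sin a" "q * sin a < sin a" using pq sa q1 by simp_all
    then show "q * sin a < 1" using sin_le_one[of a] by linarith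
  qed
  have "B < arccos 0" unfolding B_def using qs by (intro arccos_less_arccos) auto
  then show "x < a" by (simp add: xB)
  have "arccos (cos (pi / 2 - a)) < B" unfolding B_def using qs
    by (intro arccos_less_arccos) (auto simp: cos_diff)
  moreover have "arccos (cos (pi / 2 - a)) = pi / 2 - a" using a by (intro arccos_cos) auto
  ultimately show "0 < x" by (simp add: xB)
  have cosR: "cos (a - x) = cos a / R"
  proof -
    have "cos (a - x) = sin B" by (simp add: xB cos_diff)
    also have "\<dots> = sqrt (1 - (q * sin a)\<^sup>2)" unfolding B_def using qs by (intro sin_arccos) auto
    also have "1 - (q * sin a)\<^sup>2 = (cos a / R)\<^sup>2"
    proof -
      have "R\<^sup>2 - h\<^sup>2 * (sin a)\<^sup>2 = (cos a)\<^sup>2" using R2 hr(3) cs by algebra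
      moreover have "1 - (q * sin a)\<^sup>2 = (R\<^sup>2 - h\<^sup>2 * (sin a)\<^sup>2) / R\<^sup>2"
        using R0 by (simp add: q_def power_divide power_mult_distrib diff_divide_distrib)
      ultimately show ?thesis by (simp add: power_divide)
    qed
    finally show ?thesis using ca R0 by simp
  qed
  have Rx: "cos a / cos (a - x) = R" using cosR ca R0 by simp
  obtain s where s: "\<And>i. gdist unit_sphere (vert Q i) (vert Q (i + 1)) = s" "perim unit_sphere Q = real n * s"
    using regular_ngon_equal_sides[OF reg n] by blast
  have "vert Q 0 \<bullet> vert Q 1 = h\<^sup>2 + r\<^sup>2 * cos (2 * a)"
  proof -
    have "c \<bullet> dir u w t = 0" "dir u w t \<bullet> c = 0" for t
      using f(4,5) by (simp_all add: dir_def inner_simps inner_commute)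
    then show ?thesis using f(3)
      by (simp add: V inner_simps dir_inner[OF f(1)] power2_eq_square a_def)
  qed
  also have "\<dots> = cos (2 * arccos R)"
  proof -
    have "cos (2 * arccos R) = 2 * R\<^sup>2 - 1" using R0 R1 by (simp add: cos_double_cos)
    also have "\<dots> = h\<^sup>2 + r\<^sup>2 * (2 * (cos a)\<^sup>2 - 1)" using R2 hr(3) by algebra
    finally show ?thesis by (simp add: cos_double_cos)
  qed
  finally have "s = arccos (cos (2 * arccos R))" using s(1)[of 0] by (simp add: unit_sphere_def)
  \<comment> \<open>Positivity of \<open>R\<close> keeps \<open>2 * arccos R\<close> below
    \<open>pi\<close>, within the range of \<open>arccos\<close>.\<close>
  also have "\<dots> = 2 * arccos R"
  proof -
    have "arccos R \<le> arccos 0" using R0 R1 by (intro arccos_le_arccos) auto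
    then show ?thesis using R0 R1 by (intro arccos_cos) (auto intro: arccos_lbound)
  qed
  finally show "perim unit_sphere Q = 2 * real n * arccos (cos a / cos (a - x))" using s(2) Rx by simp
qed

lemma sphere_perim_le:
  fixes P :: "(real^3) polygon" and Ps :: "'i \<Rightarrow> (real^3) polygon"
  assumes n: "3 \<le> n" and fin: "finite I"
    and Ps: "\<And>i. i \<in> I \<Longrightarrow> regular_ngon unit_sphere n (Ps i)" and P: "regular_ngon unit_sphere n P"
    and area: "(\<Sum>i\<in>I. area unit_sphere (Ps i)) = area unit_sphere P"
  shows "perim unit_sphere P \<le> (\<Sum>i\<in>I. perim unit_sphere (Ps i))"
proof -
  define a X where "a = pi / real n" and "X = area unit_sphere P / (2 * real n)"
  define x where "x i = area unit_sphere (Ps i) / (2 * real n)" for i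
  define f where "f t = arccos (cos a / cos (a - t))" for t
  have X: "0 < X" "X < a" "perim unit_sphere P = 2 * real n * f X"
    using sphere_regular_perim_area[OF P n] by (simp_all add: X_def a_def f_def)
  have x: "0 < x i" "perim unit_sphere (Ps i) = 2 * real n * f (x i)" if "i \<in> I" for i
    using sphere_regular_perim_area[OF Ps[OF that] n] by (simp_all add: x_def a_def f_def)
  have sum: "(\<Sum>i\<in>I. x i) = X" using area by (simp add: x_def X_def flip: sum_divide_distrib)
  \<comment> \<open>The weights \<open>x i / X\<close> add up to 1, so summation yields
    \<open>f X\<close>; positivity of the areas gives \<open>x i \<le> X\<close>.\<close>
  have "x i / X * f X \<le> f (x i)" if "i \<in> I" for i
  proof -
    have "x i \<le> X" using member_le_sum[of i I x] that fin x(1) sum by (auto intro: less_imp_le)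
    then show ?thesis
      unfolding f_def using half_angle[OF n] X x(1)[OF that] by (intro half_side_star_shaped) (auto simp: a_def)
  qed
  then have "(\<Sum>i\<in>I. x i / X * f X) \<le> (\<Sum>i\<in>I. f (x i))" by (rule sum_mono)
  moreover have "(\<Sum>i\<in>I. x i / X * f X) = f X"
    using X(1) sum by (simp flip: sum_distrib_right sum_divide_distrib)
  ultimately have "2 * real n * f X \<le> 2 * real n * (\<Sum>i\<in>I. f (x i))" by (intro mult_left_mono) auto
  also have "\<dots> = (\<Sum>i\<in>I. perim unit_sphere (Ps i))" using x(2) by (simp add: sum_distrib_left)
  finally show ?thesis by (simp add: X)
qed

theorem proposition1p1:
  fixes n k :: nat
  assumes "n \<ge> 3" and "k \<ge> 1"
  shows
    "(\<forall>(Ps :: nat \<Rightarrow> (real^2) polygon) P.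
        (\<forall>i\<in>{1..k}. regular_ngon euclidean_plane n (Ps i)) \<longrightarrow>
        regular_ngon euclidean_plane n P \<longrightarrow>
        (\<Sum>i=1..k. area euclidean_plane (Ps i)) = area euclidean_plane P \<longrightarrow>
        perim euclidean_plane P \<le> (\<Sum>i=1..k. perim euclidean_plane (Ps i))) \<and>
     (\<forall>(Ps :: nat \<Rightarrow> (real^3) polygon) P.
        (\<forall>i\<in>{1..k}. regular_ngon unit_sphere n (Ps i)) \<longrightarrow>
        regular_ngon unit_sphere n P \<longrightarrow>
        (\<Sum>i=1..k. area unit_sphere (Ps i)) = area unit_sphere P \<longrightarrow>
        perim unit_sphere P \<le> (\<Sum>i=1..k. perim unit_sphere (Ps i)))"
proof (intro conjI allI impI)
  fix Ps :: "nat \<Rightarrow> (real^2) polygon" and P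
  assume "\<forall>i\<in>{1..k}. regular_ngon euclidean_plane n (Ps i)" "regular_ngon euclidean_plane n P"
    "(\<Sum>i=1..k. area euclidean_plane (Ps i)) = area euclidean_plane P"
  with assms(1) show "perim euclidean_plane P \<le> (\<Sum>i=1..k. perim euclidean_plane (Ps i))"
    by (intro plane_perim_le) auto
next
  fix Ps :: "nat \<Rightarrow> (real^3) polygon" and P
  assume "\<forall>i\<in>{1..k}. regular_ngon unit_sphere n (Ps i)" "regular_ngon unit_sphere n P"
    "(\<Sum>i=1..k. area unit_sphere (Ps i)) = area unit_sphere P"
  with assms(1) show "perim unit_sphere P \<le> (\<Sum>i=1..k. perim unit_sphere (Ps i))"
    by (intro sphere_perim_le) auto
qed

end
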